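(* Let $\hbar>0$, $n\in\mathbb{N}$, and let $f\in L^2(\mathbb{R}^n)$ with Wigner function $Wf$ on $\mathbb{R}^{2n}$. Suppose the negative part $\mathcal{N}_-(Wf)=\{z\in\mathbb{R}^{2n}:Wf(z)<0\}$ is nonempty and $\mathcal{N}_-(Wf)\subset B_{R_0}(z_0)$ for some $R_0>0$ and $z_0\in\mathbb{R}^{2n}$, where $B_{R_0}(z_0)$ is the ball of radius $R_0$ centered at $z_0$. Then $$R_0\geq\frac12\sqrt{\frac{\hbar}{2}\sqrt[n]{\frac{n!}{2}}}.$$
   Context: For $f\in L^2(\mathbb{R}^n)$, the Wigner function is $Wf(x,p)=\frac{1}{(2\pi\hbar)^n}\int_{\mathbb{R}^n} f(x+\tau/2)\overline{f(x-\tau/2)}e^{-\frac{i}{\hbar}p\cdot\tau}\,d\tau$, $(x,p)\in\mathbb{R}^{2n}$. *)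

theory Defs
  imports "HOL-Analysis.Analysis"
begin

definition L2 :: "(real^'n \<Rightarrow> complex) set" where
  "L2 = {f. f \<in> borel_measurable lborel \<and> integrable lborel (\<lambda>x. (cmod (f x))\<^sup>2)}"

definition wigner :: "real \<Rightarrow> (real^'n \<Rightarrow> complex) \<Rightarrow> (real^'n) \<times> (real^'n) \<Rightarrow> complex" where
  "wigner hbar f = (\<lambda>(x, p).
     complex_of_real (1 / (2 * pi * hbar) ^ CARD('n)) *
     (LINT \<tau>|lborel. f (x + (1/2) *\<^sub>R \<tau>) * cnj (f (x - (1/2) *\<^sub>R \<tau>))
                     * exp (- \<i> * complex_of_real ((p \<bullet> \<tau>) / hbar))))"

text \<open>Negative part of the (real-valued) Wigner function.\<close>
definition neg_part :: "((real^'n) \<times> (real^'n) \<Rightarrow> complex) \<Rightarrow> ((real^'n) \<times> (real^'n)) set" where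
  "neg_part W = {z. Re (W z) < 0}"

end

theory Submission
  imports Defs "HOL-Probability.Characteristic_Functions"
begin

text \<open>
  Up to the positive factor \<open>(\<pi> hbar)\<^sup>-\<^sup>n\<close> and the rescaling \<open>q = 2 p / hbar\<close> the Wigner
  function is \<open>A (y, q) = \<integral> f (y + t) cnj (f (y - t)) e\<^sup>-\<^sup>i\<^sup>q\<^sup>t dt\<close>, a continuous real function.
  For a point \<open>z\<close> put \<open>G w = A (z + w) A (z - w)\<close>. By Moyal's identity \<open>G\<close> is integrable and, up to
  scaling, its own (symplectic) Fourier transform; in particular \<open>\<integral> G = \<pi>\<^sup>n G 0\<close> and
  \<open>\<pi>\<^sup>n \<bar>G w\<bar> \<le> \<integral> \<bar>G\<bar>\<close> for all \<open>w\<close>.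

  Choose \<open>z\<close> with \<open>A z = 0\<close> and \<open>G\<close> not identically zero. Then \<open>\<integral> G = 0\<close>, and \<open>G\<close> is nonnegative off
  a set \<open>D\<close> whose measure is at most twice that of the negative set \<open>N\<close> of \<open>A\<close>. As in the uncertainty
  principle of Bourgain, Clozel and Kahane,
  \<open>\<integral> \<bar>G\<bar> = \<integral> (\<bar>G\<bar> - G) \<le> 2 \<mu>(D) sup \<bar>G\<bar> \<le> 4 \<pi>\<^sup>-\<^sup>n \<mu>(N) \<integral> \<bar>G\<bar>\<close>,
  so \<open>\<mu>(N) \<ge> \<pi>\<^sup>n / 4\<close>; comparing with the volume of the ball gives the bound on the radius.

  If no such \<open>z\<close> existed, the open set where \<open>A\<close> does not vanish would be closed under midpoints, hence
  convex, and \<open>A\<close> would be nonpositive. This is impossible because the integral of \<open>A\<close> against the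
  (positive) Wigner function of a Gaussian is nonnegative, again by Moyal's identity.
\<close>

section \<open>Square-integrable functions\<close>

lemma nn_integral_lborel_affine:
  fixes c :: real and t :: "'a::euclidean_space"
  assumes [measurable]: "h \<in> borel_measurable borel" and c: "c \<noteq> 0"
  shows "(\<integral>\<^sup>+x. h x \<partial>lborel) = \<bar>c\<bar> ^ DIM('a) * (\<integral>\<^sup>+x. h (t + c *\<^sub>R x) \<partial>lborel)"
  by (subst lborel_affine[OF c, of t])
     (simp add: nn_integral_density nn_integral_distr nn_integral_cmult)

lemma integrable_lborel_affine:
  fixes h :: "'a::euclidean_space \<Rightarrow> 'b::{banach, second_countable_topology}"
  assumes h: "integrable lborel h" and c: "c \<noteq> 0"
  shows "integrable lborel (\<lambda>x. h (t + c *\<^sub>R x))"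
proof -
  have [measurable]: "h \<in> borel_measurable borel"
    using borel_measurable_integrable[OF h] by simp
  have "(\<integral>\<^sup>+x. norm (h x) \<partial>lborel) < \<infinity>"
    using h by (simp add: integrable_iff_bounded)
  then have "(\<integral>\<^sup>+x. norm (h (t + c *\<^sub>R x)) \<partial>lborel) < \<infinity>"
    using c by (subst (asm) nn_integral_lborel_affine[where c=c and t=t]) (auto simp: ennreal_mult_less_top)
  then show ?thesis
    by (auto simp: integrable_iff_bounded)
qed

lemma integrable_lborel_affine_iff:
  fixes h :: "'a::euclidean_space \<Rightarrow> 'b::{banach, second_countable_topology}"
  assumes c: "c \<noteq> 0"
  shows "integrable lborel (\<lambda>x. h (t + c *\<^sub>R x)) \<longleftrightarrow> integrable lborel h"
proof
  assume "integrable lborel (\<lambda>x. h (t + c *\<^sub>R x))"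
  from integrable_lborel_affine[OF this, of "1/c" "-(1/c) *\<^sub>R t"] c
  show "integrable lborel h" by (simp add: algebra_simps)
qed (simp add: integrable_lborel_affine c)

text \<open>Covers nonintegrable \<open>h\<close> as well: by the equivalence above, both Bochner
  integrals then have the default value 0.\<close>

lemma integral_lborel_affine:
  fixes h :: "'a::euclidean_space \<Rightarrow> 'b::{banach, second_countable_topology}"
  assumes c: "c \<noteq> 0"
  shows "(\<integral>x. h x \<partial>lborel) = \<bar>c\<bar> ^ DIM('a) *\<^sub>R (\<integral>x. h (t + c *\<^sub>R x) \<partial>lborel)"
proof (cases "integrable lborel h")
  case True
  then have [measurable]: "h \<in> borel_measurable borel"
    using borel_measurable_integrable by fastforce
  show ?thesis
    using c by (subst lborel_affine[OF c, of t]) (simp add: integral_density integral_distr)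
next
  case False
  with c show ?thesis
    by (simp add: integrable_lborel_affine_iff not_integrable_integral_eq)
qed

lemma integral_lborel_translate:
  fixes h :: "'a::euclidean_space \<Rightarrow> 'b::{banach, second_countable_topology}"
  shows "(\<integral>x. h (t + x) \<partial>lborel) = (\<integral>x. h x \<partial>lborel)"
  using integral_lborel_affine[of 1 h t] by simp

lemma integral_lborel_reflect:
  fixes h :: "'a::euclidean_space \<Rightarrow> 'b::{banach, second_countable_topology}"
  shows "(\<integral>x. h (t - x) \<partial>lborel) = (\<integral>x. h x \<partial>lborel)"
  using integral_lborel_affine[of "-1" h t] by simp

lemma integrable_lborel_translate_iff:
  fixes h :: "'a::euclidean_space \<Rightarrow> 'b::{banach, second_countable_topology}"
  shows "integrable lborel (\<lambda>x. h (t + x)) \<longleftrightarrow> integrable lborel h"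
  using integrable_lborel_affine_iff[of 1 h t] by simp

lemma integrable_lborel_reflect_iff:
  fixes h :: "'a::euclidean_space \<Rightarrow> 'b::{banach, second_countable_topology}"
  shows "integrable lborel (\<lambda>x. h (t - x)) \<longleftrightarrow> integrable lborel h"
  using integrable_lborel_affine_iff[of "-1" h t] by simp

text \<open>Stated over any Euclidean space, since it is applied both to functions of position and
  to Wigner functions on the phase space \<open>'a \<times> 'a\<close>.\<close>

definition square_integrable :: "('a::euclidean_space \<Rightarrow> complex) \<Rightarrow> bool" where
  "square_integrable f \<longleftrightarrow> f \<in> borel_measurable borel \<and> integrable lborel (\<lambda>x. (cmod (f x))\<^sup>2)"

lemma square_integrable_bound:
  assumes "integrable lborel h" "f \<in> borel_measurable borel" "\<And>x. (cmod (f x))\<^sup>2 \<le> h x"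
  shows "square_integrable f"
  unfolding square_integrable_def
  using assms by (auto intro!: Bochner_Integration.integrable_bound[OF assms(1)] AE_I2 order_trans[OF _ abs_ge_self])

lemma norm_add_sq_le: "(norm (a + b))\<^sup>2 \<le> 2 * (norm a)\<^sup>2 + 2 * (norm (b::'a::real_normed_vector))\<^sup>2"
proof -
  have "(norm (a + b))\<^sup>2 \<le> (norm a + norm b)\<^sup>2"
    by (intro power_mono norm_triangle_ineq norm_ge_zero)
  also have "\<dots> \<le> 2 * (norm a)\<^sup>2 + 2 * (norm b)\<^sup>2"
    using sum_squares_bound[of "norm a" "norm b"] by (simp add: power2_sum)
  finally show ?thesis .
qed

lemma square_integrable_add:
  assumes "square_integrable f" "square_integrable g"
  shows "square_integrable (\<lambda>x. f x + g x)"
  using assms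
  by (intro square_integrable_bound[where h="\<lambda>x. 2 * (cmod (f x))\<^sup>2 + 2 * (cmod (g x))\<^sup>2"])
     (auto simp: square_integrable_def norm_add_sq_le)

lemma square_integrable_diff:
  assumes "square_integrable f" "square_integrable g"
  shows "square_integrable (\<lambda>x. f x - g x)"
  using square_integrable_add[OF assms(1), of "\<lambda>x. - g x"] assms(2)
  by (simp add: square_integrable_def)

lemma square_integrable_cnj: "square_integrable f \<Longrightarrow> square_integrable (\<lambda>x. cnj (f x))"
  by (auto simp: square_integrable_def intro: borel_measurable_continuous_on[where f=cnj] continuous_intros)

lemma square_integrable_unimodular:
  assumes "square_integrable f" "k \<in> borel_measurable borel" "\<And>x. cmod (k x) = 1"
  shows "square_integrable (\<lambda>x. f x * k x)"
  using assms by (auto simp: square_integrable_def norm_mult power_mult_distrib)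

lemma square_integrable_translate:
  "square_integrable f \<Longrightarrow> square_integrable (\<lambda>x. f (t + x))"
  by (auto simp: square_integrable_def integrable_lborel_translate_iff[of "\<lambda>x. (cmod (f x))\<^sup>2"])

lemma square_integrable_reflect:
  "square_integrable f \<Longrightarrow> square_integrable (\<lambda>x. f (t - x))"
  by (auto simp: square_integrable_def integrable_lborel_reflect_iff[of "\<lambda>x. (cmod (f x))\<^sup>2"])

lemma integrable_mult_square_integrable:
  assumes "square_integrable f" "square_integrable g"
  shows "integrable lborel (\<lambda>x. f x * g x)"
proof (rule Bochner_Integration.integrable_bound)
  show "integrable lborel (\<lambda>x. (cmod (f x))\<^sup>2 + (cmod (g x))\<^sup>2)"
    using assms by (auto simp: square_integrable_def)
  show "AE x in lborel. cmod (f x * g x) \<le> norm ((cmod (f x))\<^sup>2 + (cmod (g x))\<^sup>2)"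
  proof (rule AE_I2)
    fix x
    have "2 * (cmod (f x) * cmod (g x)) \<le> (cmod (f x))\<^sup>2 + (cmod (g x))\<^sup>2"
      using sum_squares_bound[of "cmod (f x)" "cmod (g x)"] by (simp add: mult.assoc)
    moreover have "0 \<le> cmod (f x) * cmod (g x)" by simp
    ultimately show "cmod (f x * g x) \<le> norm ((cmod (f x))\<^sup>2 + (cmod (g x))\<^sup>2)"
      unfolding norm_mult real_norm_def by linarith
  qed
qed (use assms in \<open>auto simp: square_integrable_def\<close>)

text \<open>The inequality \<open>2 a b \<le> a^2 / d + d b^2\<close>, integrated; it stands in for
  Cauchy-Schwarz. The free weight \<open>d\<close> allows the term with \<open>g\<close> to be made
  small first, and the term with \<open>f\<close> afterwards.\<close>

lemma integral_norm_mult_le: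
  assumes "square_integrable f" "square_integrable g" "d > 0"
  shows "(\<integral>x. cmod (f x * g x) \<partial>lborel)
    \<le> (\<integral>x. (cmod (f x))\<^sup>2 \<partial>lborel) / d + d * (\<integral>x. (cmod (g x))\<^sup>2 \<partial>lborel)"
proof -
  have "(\<integral>x. cmod (f x * g x) \<partial>lborel) \<le> (\<integral>x. (cmod (f x))\<^sup>2 / d + d * (cmod (g x))\<^sup>2 \<partial>lborel)"
  proof (rule integral_mono)
    show "integrable lborel (\<lambda>x. cmod (f x * g x))"
      using integrable_mult_square_integrable[OF assms(1,2)] by simp
    show "integrable lborel (\<lambda>x. (cmod (f x))\<^sup>2 / d + d * (cmod (g x))\<^sup>2)"
      using assms by (auto simp: square_integrable_def)
    fix x
    have "2 * (cmod (f x) / sqrt d) * (sqrt d * cmod (g x)) \<le> (cmod (f x) / sqrt d)\<^sup>2 + (sqrt d * cmod (g x))\<^sup>2"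
      by (rule sum_squares_bound)
    then have "2 * (cmod (f x) * cmod (g x)) \<le> (cmod (f x))\<^sup>2 / d + d * (cmod (g x))\<^sup>2"
      using assms(3) by (simp add: power_divide power_mult_distrib)
    moreover have "0 \<le> cmod (f x) * cmod (g x)" by simp
    ultimately show "cmod (f x * g x) \<le> (cmod (f x))\<^sup>2 / d + d * (cmod (g x))\<^sup>2"
      unfolding norm_mult by linarith
  qed
  also have "\<dots> = (\<integral>x. (cmod (f x))\<^sup>2 \<partial>lborel) / d + d * (\<integral>x. (cmod (g x))\<^sup>2 \<partial>lborel)"
    using assms by (simp add: square_integrable_def)
  finally show ?thesis .
qed

section \<open>Continuity of modulated convolutions\<close>

text \<open>The common form behind convolutions and Wigner functions: \<open>q = 0\<close> gives a
  plain convolution, and \<open>u = y + t\<close>, \<open>s = 2 y\<close> turns a Wigner integral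
  into it up to a phase.\<close>

definition mod_conv :: "('a::euclidean_space \<Rightarrow> complex) \<Rightarrow> ('a \<Rightarrow> complex) \<Rightarrow> 'a \<times> 'a \<Rightarrow> complex" where
  "mod_conv f g = (\<lambda>(s, q). LINT u|lborel. f u * g (s - u) * cis (- (q \<bullet> u)))"

lemma borel_measurable_cis [measurable (raw)]:
  "h \<in> borel_measurable M \<Longrightarrow> (\<lambda>x. cis (h x)) \<in> borel_measurable M"
  by (rule borel_measurable_continuous_on) (auto intro!: continuous_intros simp: cis_conv_exp)

lemma mod_conv_integrable:
  assumes "square_integrable f" "square_integrable g"
  shows "integrable lborel (\<lambda>u. f u * g (s - u) * cis (- (q \<bullet> u)))"
  using integrable_mult_square_integrable[OF square_integrable_unimodular[OF assms(1)] square_integrable_reflect[OF assms(2)],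
      of "\<lambda>u. cis (- (q \<bullet> u))" s]
  by (simp add: mult_ac)

text \<open>Reflection, translation and the unimodular phase preserve the L2 norm, so the bound is
  uniform in \<open>z\<close>.\<close>

lemma norm_mod_conv_le:
  assumes "square_integrable f" "square_integrable g" "d > 0"
  shows "cmod (mod_conv f g z) \<le> (\<integral>x. (cmod (f x))\<^sup>2 \<partial>lborel) / d + d * (\<integral>x. (cmod (g x))\<^sup>2 \<partial>lborel)"
proof -
  obtain s q where z: "z = (s, q)" by force
  have "cmod (mod_conv f g z) \<le> (\<integral>u. cmod (f u * g (s - u) * cis (- (q \<bullet> u))) \<partial>lborel)"
    unfolding z mod_conv_def by (auto intro: integral_norm_bound)
  also have "\<dots> = (\<integral>u. cmod (f u * g (s - u)) \<partial>lborel)"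
    by (simp add: norm_mult)
  also have "\<dots> \<le> (\<integral>x. (cmod (f x))\<^sup>2 \<partial>lborel) / d + d * (\<integral>x. (cmod (g (s - x)))\<^sup>2 \<partial>lborel)"
    by (intro integral_norm_mult_le assms square_integrable_reflect)
  also have "(\<integral>x. (cmod (g (s - x)))\<^sup>2 \<partial>lborel) = (\<integral>x. (cmod (g x))\<^sup>2 \<partial>lborel)"
    by (rule integral_lborel_reflect)
  finally show ?thesis .
qed

lemma mod_conv_diff:
  assumes "square_integrable f" "square_integrable f'" "square_integrable g"
  shows "mod_conv f g z - mod_conv f' g z = mod_conv (\<lambda>x. f x - f' x) g z"
proof -
  obtain s q where z: "z = (s, q)" by force
  show ?thesis
    unfolding z mod_conv_def prod.case
    using Bochner_Integration.integral_diff[OF mod_conv_integrable[OF assms(1,3), of s q] mod_conv_integrable[OF assms(2,3), of s q]]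
    by (simp add: left_diff_distrib)
qed

text \<open>By the uniform bound, L2 convergence of the first factor gives uniform convergence of
  the modulated convolutions, and uniform limits preserve continuity.\<close>

lemma mod_conv_continuous_limit:
  assumes f: "square_integrable f" and F: "\<And>n. square_integrable (F n)" and g: "square_integrable g"
    and lim: "(\<lambda>n. \<integral>x. (cmod (f x - F n x))\<^sup>2 \<partial>lborel) \<longlonglongrightarrow> 0"
    and cont: "\<And>n. continuous_on UNIV (mod_conv (F n) g)"
  shows "continuous_on UNIV (mod_conv f g)"
proof (rule uniform_limit_theorem)
  show "uniform_limit UNIV (\<lambda>n. mod_conv (F n) g) (mod_conv f g) sequentially"
  proof (rule uniform_limitI)
    fix e :: real assume e: "e > 0"
    define N where "N = (\<integral>x. (cmod (g x))\<^sup>2 \<partial>lborel)"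
    have N: "N \<ge> 0" by (simp add: N_def)
    \<comment> \<open>With this \<open>d\<close> the term from \<open>g\<close> stays below
      \<open>e / 2\<close>, and an error below \<open>d * (e / 2)\<close> in the squared L2 norm
      makes the other term smaller than \<open>e / 2\<close>. The \<open>+ 1\<close> covers a
      \<open>g\<close> of norm zero.\<close>
    define d where "d = e / (2 * (N + 1))"
    have d: "d > 0" using N e by (simp add: d_def)
    have dN: "d * N < e / 2" using N e by (simp add: d_def field_simps)
    have "\<forall>\<^sub>F n in sequentially. (\<integral>x. (cmod (f x - F n x))\<^sup>2 \<partial>lborel) < d * (e / 2)"
      by (rule order_tendstoD(2)[OF lim]) (use d e in simp)
    then show "\<forall>\<^sub>F n in sequentially. \<forall>z\<in>UNIV. dist (mod_conv (F n) g z) (mod_conv f g z) < e"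
    proof (eventually_elim, intro ballI)
      fix n z
      assume n: "(\<integral>x. (cmod (f x - F n x))\<^sup>2 \<partial>lborel) < d * (e / 2)"
      have "dist (mod_conv (F n) g z) (mod_conv f g z) = cmod (mod_conv (\<lambda>x. f x - F n x) g z)"
        by (simp add: dist_commute dist_norm mod_conv_diff[OF f F g])
      also have "\<dots> \<le> (\<integral>x. (cmod (f x - F n x))\<^sup>2 \<partial>lborel) / d + d * N"
        unfolding N_def by (intro norm_mod_conv_le square_integrable_diff f F g d)
      also have "(\<integral>x. (cmod (f x - F n x))\<^sup>2 \<partial>lborel) / d < e / 2"
        using n d by (simp add: field_simps)
      finally show "dist (mod_conv (F n) g z) (mod_conv f g z) < e" using dN by simp
    qed
  qed
qed (use cont in auto)

section \<open>Continuity for growing classes of first factors: continuous, indicator,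
  general\<close>

lemma square_integrable_bounded_support:
  assumes [measurable]: "f \<in> borel_measurable borel" and B: "\<And>x. cmod (f x) \<le> B" and r: "\<And>x. norm x > r \<Longrightarrow> f x = 0"
  shows "square_integrable f"
proof (rule square_integrable_bound)
  show "integrable lborel (\<lambda>x. B\<^sup>2 * indicator (cball (0::'a) r) x)"
    by (intro integrable_mult_right integrable_real_indicator emeasure_bounded_finite) auto
  fix x
  show "(cmod (f x))\<^sup>2 \<le> B\<^sup>2 * indicator (cball 0 r) x"
    using r[of x] B[of x] by (auto simp: indicator_def intro!: power_mono)
qed simp

lemma mod_conv_continuous_if_continuous:
  assumes f: "continuous_on UNIV f" and r: "\<And>x. norm x > r \<Longrightarrow> f x = 0" and g: "square_integrable g"
  shows "continuous_on UNIV (mod_conv f g)"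
proof -
  have [measurable]: "f \<in> borel_measurable borel" "g \<in> borel_measurable borel"
    using f g by (auto intro: borel_measurable_continuous_onI simp: square_integrable_def)
  obtain B where B: "B > 0" "\<And>x. cmod (f x) \<le> B"
  proof -
    have "bounded (f ` cball 0 r)"
      using f by (intro compact_imp_bounded compact_continuous_image) (auto intro: continuous_on_subset)
    then obtain B where "B > 0" "\<And>x. x \<in> cball 0 r \<Longrightarrow> cmod (f x) \<le> B"
      by (auto simp: bounded_pos)
    then show thesis
      using r that[of B] by (metis mem_cball_0 not_le norm_zero less_imp_le)
  qed
  \<comment> \<open>Reflecting \<open>u\<close> about \<open>s\<close> frees the merely
    square-integrable \<open>g\<close> from the parameters: they enter only through the continuous
    \<open>f\<close> and the phase, so dominated convergence applies.\<close>
  have eq: "mod_conv f g (s, q) = (\<integral>u. f (s - u) * g u * cis (- (q \<bullet> (s - u))) \<partial>lborel)" for s q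
    unfolding mod_conv_def prod.case
    by (subst integral_lborel_reflect[where t=s, symmetric]) simp
  have "(\<lambda>n. mod_conv f g (z n)) \<longlonglongrightarrow> mod_conv f g a" if z: "z \<longlonglongrightarrow> a" for z a
  proof -
    have z1: "(\<lambda>n. fst (z n)) \<longlonglongrightarrow> fst a" and z2: "(\<lambda>n. snd (z n)) \<longlonglongrightarrow> snd a"
      using z by (auto intro: tendsto_intros)
    \<comment> \<open>A convergent sequence is bounded, so all the reflected translates of
      \<open>f\<close> are supported in one ball of radius \<open>S + r\<close> and share a
      majorant.\<close>
    obtain S where S: "\<And>n. norm (fst (z n)) \<le> S"
      using z1 convergent_imp_bounded[OF z1] by (auto simp: bounded_iff)
    have "(\<lambda>n. \<integral>u. f (fst (z n) - u) * g u * cis (- (snd (z n) \<bullet> (fst (z n) - u))) \<partial>lborel)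
      \<longlonglongrightarrow> (\<integral>u. f (fst a - u) * g u * cis (- (snd a \<bullet> (fst a - u))) \<partial>lborel)"
    proof (rule integral_dominated_convergence)
      have "square_integrable (\<lambda>u. of_real (B * indicator (cball (0::'a) (S + r)) u))"
        by (rule square_integrable_bounded_support[where B=B and r="S+r"]) (use B in \<open>auto simp: indicator_def\<close>)
      from integrable_norm[OF integrable_mult_square_integrable[OF this g]]
      show "integrable lborel (\<lambda>u. cmod (of_real (B * indicator (cball 0 (S + r)) u) * g u))" .
      show "AE u in lborel. (\<lambda>n. f (fst (z n) - u) * g u * cis (- (snd (z n) \<bullet> (fst (z n) - u))))
        \<longlonglongrightarrow> f (fst a - u) * g u * cis (- (snd a \<bullet> (fst a - u)))"
      proof (rule AE_I2)
        fix u
        have "(\<lambda>n. f (fst (z n) - u)) \<longlonglongrightarrow> f (fst a - u)"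
          by (rule continuous_on_tendsto_compose[OF f]) (auto intro!: tendsto_intros z1)
        moreover have "(\<lambda>n. cis (- (snd (z n) \<bullet> (fst (z n) - u)))) \<longlonglongrightarrow> cis (- (snd a \<bullet> (fst a - u)))"
          unfolding cis_conv_exp by (intro tendsto_intros z1 z2)
        ultimately show "(\<lambda>n. f (fst (z n) - u) * g u * cis (- (snd (z n) \<bullet> (fst (z n) - u))))
        \<longlonglongrightarrow> f (fst a - u) * g u * cis (- (snd a \<bullet> (fst a - u)))"
          by (intro tendsto_mult tendsto_const)
      qed
      fix n
      show "AE u in lborel. cmod (f (fst (z n) - u) * g u * cis (- (snd (z n) \<bullet> (fst (z n) - u))))
          \<le> cmod (of_real (B * indicator (cball 0 (S + r)) u) * g u)"
      proof (rule AE_I2)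
        fix u
        have "cmod (f (fst (z n) - u)) \<le> B * indicator (cball 0 (S + r)) u"
        proof (cases "norm u \<le> S + r")
          case False
          have "norm u \<le> norm (fst (z n)) + norm (fst (z n) - u)"
            by (metis norm_minus_commute norm_triangle_sub)
          with False S[of n] have "norm (fst (z n) - u) > r" by linarith
          with r show ?thesis using B by simp
        qed (use B in simp)
        then show "cmod (f (fst (z n) - u) * g u * cis (- (snd (z n) \<bullet> (fst (z n) - u))))
          \<le> cmod (of_real (B * indicator (cball 0 (S + r)) u) * g u)"
          using B(1) by (auto simp: norm_mult abs_mult intro!: mult_right_mono)
      qed
    qed measurable
    then show ?thesis
      by (simp flip: eq)
  qed
  then show ?thesis
    by (simp add: continuous_on_sequentially o_def)
qed

lemma indicator_square_integrable:
  assumes "E \<in> sets borel" "E \<subseteq> ball 0 r"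
  shows "square_integrable (\<lambda>x. complex_of_real (indicator E (x::'a::euclidean_space)))"
  by (rule square_integrable_bounded_support[where B=1 and r=r])
     (use assms in \<open>auto simp: indicator_def subset_eq\<close>)

lemma mod_conv_continuous_open:
  assumes U: "open U" "U \<subseteq> ball 0 r" and g: "square_integrable g"
  shows "continuous_on UNIV (mod_conv (\<lambda>x. of_real (indicator U x)) g)"
proof -
  \<comment> \<open>Continuous cut-offs increasing pointwise to the indicator of \<open>U\<close>:
    at a point of \<open>U\<close> they equal 1 as soon as \<open>n\<close> reaches the reciprocal
    of the distance to the complement.\<close>
  define F :: "nat \<Rightarrow> 'a \<Rightarrow> complex" where "F n x = of_real (min 1 (n * infdist x (- U)))" for n x
  have F: "continuous_on UNIV (F n)" for n
    unfolding F_def by (intro continuous_intros)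
  \<comment> \<open>The distance to the empty set is 0 by convention, which would spoil the
    cut-offs; boundedness of \<open>U\<close> excludes this.\<close>
  have bU: "- U \<noteq> {}"
    using U(2) by (metis Compl_empty_eq double_complement not_bounded_UNIV bounded_subset bounded_ball)
  have F0: "F n x = 0" if "x \<notin> U" for n x
    using that by (simp add: F_def)
  have F1: "cmod (F n x) \<le> 1" for n x
    using infdist_nonneg[of x "-U"] by (simp add: F_def)
  have [measurable]: "F n \<in> borel_measurable borel" "U \<in> sets borel" for n
    using F U by (auto intro: borel_measurable_continuous_onI)
  show ?thesis
  proof (rule mod_conv_continuous_limit[where F=F])
    show "square_integrable (\<lambda>x. complex_of_real (indicator U x))"
      using U by (intro indicator_square_integrable) auto
    show "square_integrable (F n)" for n
      by (rule square_integrable_bounded_support[where B=1 and r=r]) (use F0 F1 U(2) in \<open>auto simp: subset_eq, metis less_asym\<close>)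
    show "continuous_on UNIV (mod_conv (F n) g)" for n
      by (rule mod_conv_continuous_if_continuous[OF F _ g, of r]) (use F0 U in \<open>auto simp: subset_eq, metis less_asym\<close>)
    have "(\<lambda>n. \<integral>x. (cmod (of_real (indicator U x) - F n x))\<^sup>2 \<partial>lborel) \<longlonglongrightarrow> (\<integral>x. 0 \<partial>(lborel :: 'a measure))"
    proof (rule integral_dominated_convergence)
      show "integrable lborel (\<lambda>x. 4 * indicator (ball (0::'a) r) x :: real)"
        by (intro integrable_mult_right integrable_real_indicator emeasure_bounded_finite) auto
      show "AE x in lborel. (\<lambda>n. (cmod (of_real (indicator U x) - F n x))\<^sup>2) \<longlonglongrightarrow> 0"
      proof (rule AE_I2)
        fix x
        have "(\<lambda>n. of_real (indicator U x) - F n x) \<longlonglongrightarrow> 0"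
        proof (cases "x \<in> U")
          case True
          then have p: "infdist x (- U) > 0"
            using infdist_pos_not_in_closed[of "-U" x] U bU by (simp add: closed_Compl)
          obtain m :: nat where m: "1 / infdist x (- U) \<le> m" using real_arch_simple by blast
          have "F n x = 1" if "n \<ge> m" for n
          proof -
            have "1 / infdist x (- U) \<le> real n" using m that by simp
            then have "1 \<le> n * infdist x (-U)" using p by (simp add: field_simps)
            then show ?thesis by (simp add: F_def)
          qed
          then show ?thesis using True
            by (intro tendsto_eventually) (auto simp: eventually_sequentially)
        qed (simp add: F0)
        then show "(\<lambda>n. (cmod (of_real (indicator U x) - F n x))\<^sup>2) \<longlonglongrightarrow> 0"
          using tendsto_power[OF tendsto_norm[of _ "0::complex"], of _ _ 2] by fastforce
      qed
      fix n
      show "AE x in lborel. norm ((cmod (of_real (indicator U x) - F n x))\<^sup>2) \<le> 4 * indicator (ball 0 r) x"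
      proof (rule AE_I2)
        fix x
        show "norm ((cmod (of_real (indicator U x) - F n x))\<^sup>2) \<le> 4 * indicator (ball 0 r) x"
        proof (cases "x \<in> U")
          case True
          then have "cmod (of_real (indicator U x) - F n x) \<le> 2"
            using norm_triangle_ineq4[of "of_real (indicator U x)" "F n x"] F1[of n x] by simp
          then have "(cmod (of_real (indicator U x) - F n x))\<^sup>2 \<le> 2\<^sup>2"
            by (intro power_mono) auto
          then show ?thesis using True U by auto
        qed (simp add: F0)
      qed
    qed measurable
    then show "(\<lambda>n. \<integral>x. (cmod (of_real (indicator U x) - F n x))\<^sup>2 \<partial>lborel) \<longlonglongrightarrow> 0" by simp
  qed (rule g)
qed

text \<open>Outer regularity approximates \<open>E\<close> in measure by open supersets, and for
  nested sets the measure of the difference is the squared L2 distance of the indicators.\<close>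

lemma mod_conv_continuous_indicator:
  assumes E[measurable]: "E \<in> sets borel" and r: "E \<subseteq> ball 0 r" and g: "square_integrable g"
  shows "continuous_on UNIV (mod_conv (\<lambda>x. of_real (indicator E x)) g)"
proof -
  have "\<exists>U. open U \<and> E \<subseteq> U \<and> U \<subseteq> ball 0 r \<and> measure lborel (U - E) < inverse (real (Suc n))" for n
  proof -
    obtain U where U: "open U" "E \<subseteq> U" "emeasure lborel (U - E) < ennreal (inverse (real (Suc n)))"
      using outer_regular_lborel[OF E, of "inverse (real (Suc n))"] by auto
    \<comment> \<open>Cutting \<open>U\<close> down to the ball keeps the support bounded and does
      not increase the excess over \<open>E\<close>.\<close>
    have "emeasure lborel ((U \<inter> ball 0 r) - E) \<le> emeasure lborel (U - E)"
      using U(1) by (intro emeasure_mono) auto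
    with U have *: "emeasure lborel ((U \<inter> ball 0 r) - E) < ennreal (inverse (real (Suc n)))"
      by auto
    then have "measure lborel ((U \<inter> ball 0 r) - E) < inverse (real (Suc n))"
      unfolding measure_def by (subst enn2real_less_iff) (auto intro: less_trans)
    with U r show ?thesis by (intro exI[of _ "U \<inter> ball 0 r"]) auto
  qed
  then obtain U where U: "\<And>n. open (U n)" "\<And>n. E \<subseteq> U n" "\<And>n. U n \<subseteq> ball 0 r"
      "\<And>n. measure lborel (U n - E) < inverse (real (Suc n))"
    by metis
  have [measurable]: "U n \<in> sets borel" for n using U(1) by auto
  show ?thesis
  proof (rule mod_conv_continuous_limit[where F="\<lambda>n x. of_real (indicator (U n) x)"])
    show "square_integrable (\<lambda>x. complex_of_real (indicator E x))"
      "square_integrable (\<lambda>x. complex_of_real (indicator (U n) x))" for n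
      by (rule indicator_square_integrable[OF _ r] indicator_square_integrable[OF _ U(3)], simp)+
    show "continuous_on UNIV (mod_conv (\<lambda>x. complex_of_real (indicator (U n) x)) g)" for n
      by (rule mod_conv_continuous_open[OF U(1) U(3) g])
    have "(\<integral>x. (cmod (of_real (indicator E x) - of_real (indicator (U n) x)))\<^sup>2 \<partial>lborel)
      = (\<integral>x. indicator (U n - E) x \<partial>(lborel :: 'a measure))" for n
      using U(2)[of n] by (intro Bochner_Integration.integral_cong) (auto simp: indicator_def)
    then have "(\<integral>x. (cmod (of_real (indicator E x) - of_real (indicator (U n) x)))\<^sup>2 \<partial>(lborel :: 'a measure))
      = measure lborel (U n - E)" for n
      by simp
    moreover have "(\<lambda>n. measure lborel (U n - E)) \<longlonglongrightarrow> 0"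
      by (rule tendsto_sandwich[OF _ _ tendsto_const LIMSEQ_inverse_real_of_nat])
         (use U(4) in \<open>auto intro!: always_eventually less_imp_le\<close>)
    ultimately show "(\<lambda>n. \<integral>x. (cmod (of_real (indicator E x) - of_real (indicator (U n) x)))\<^sup>2 \<partial>(lborel :: 'a measure)) \<longlonglongrightarrow> 0"
      by simp
  qed (rule g)
qed

lemma mod_conv_sum:
  fixes h :: "'i \<Rightarrow> 'b::euclidean_space \<Rightarrow> complex"
  assumes "finite I" "\<And>i. i \<in> I \<Longrightarrow> square_integrable (h i)" "square_integrable g"
  shows "mod_conv (\<lambda>x. \<Sum>i\<in>I. c i * h i x) g = (\<lambda>z. \<Sum>i\<in>I. c i * mod_conv (h i) g z)"
proof
  fix z :: "'b \<times> 'b"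
  obtain s q where z: "z = (s, q)" by force
  have "(\<Sum>i\<in>I. c i * mod_conv (h i) g z) = (\<Sum>i\<in>I. (\<integral>u. c i * (h i u * g (s - u) * cis (- (q \<bullet> u))) \<partial>lborel))"
    unfolding z mod_conv_def by simp
  also have "\<dots> = (\<integral>u. (\<Sum>i\<in>I. c i * (h i u * g (s - u) * cis (- (q \<bullet> u)))) \<partial>lborel)"
    by (rule Bochner_Integration.integral_sum[symmetric])
       (intro integrable_mult_right mod_conv_integrable assms)
  finally show "mod_conv (\<lambda>x. \<Sum>i\<in>I. c i * h i x) g z = (\<Sum>i\<in>I. c i * mod_conv (h i) g z)"
    by (simp add: z mod_conv_def sum_distrib_right mult.assoc)
qed

text \<open>Simple functions with bounded support approximate \<open>f\<close> in L2, and by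
  linearity their modulated convolutions are finite sums of the indicator case.\<close>

theorem mod_conv_continuous:
  fixes f :: "'a::euclidean_space \<Rightarrow> complex"
  assumes f: "square_integrable f" and g: "square_integrable g"
  shows "continuous_on UNIV (mod_conv f g)"
proof -
  have [measurable]: "f \<in> borel_measurable borel" using f by (simp add: square_integrable_def)
  obtain S where S: "\<And>i. simple_function lborel (S i)" "\<And>x. (\<lambda>i. S i x) \<longlonglongrightarrow> f x"
      "\<And>i x. dist (S i x) 0 \<le> 2 * dist (f x) 0"
    using borel_measurable_implies_sequence_metric[of f lborel 0] by auto
  have [measurable]: "S i \<in> borel_measurable borel" for i
    using borel_measurable_simple_function[OF S(1)[of i]] by simp
  \<comment> \<open>The cut-off makes every level set bounded, including that of the value 0, so
    that each indicator is itself square integrable.\<close>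
  define F :: "nat \<Rightarrow> 'a \<Rightarrow> complex" where "F n x = indicator (ball 0 (real n)) x * S n x" for n x
  have [measurable]: "F n \<in> borel_measurable borel" for n
  proof -
    have [measurable]: "ball (0::'a) (real n) \<in> sets borel" by simp
    show ?thesis unfolding F_def by measurable
  qed
  have F_le: "cmod (F n x) \<le> 2 * cmod (f x)" for n x
    using S(3)[of n x] by (auto simp: F_def indicator_def)
  have F: "square_integrable (F n)" for n
  proof (rule square_integrable_bound[where h="\<lambda>x. 4 * (cmod (f x))\<^sup>2"])
    show "integrable lborel (\<lambda>x. 4 * (cmod (f x))\<^sup>2)"
      using f by (simp add: square_integrable_def)
    show "(cmod (F n x))\<^sup>2 \<le> 4 * (cmod (f x))\<^sup>2" for x
      using power_mono[OF F_le[of n x] norm_ge_zero, of 2] by simp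
  qed simp
  show ?thesis
  proof (rule mod_conv_continuous_limit[OF f F g])
    fix n
    let ?E = "\<lambda>c. S n -` {c} \<inter> ball 0 (real n)"
    have fin: "finite (range (S n))" using simple_functionD(1)[OF S(1)[of n]] by simp
    have "F n x = (\<Sum>c\<in>range (S n). c * of_real (indicator (?E c) x))" for x
    proof -
      have "(\<Sum>c\<in>range (S n). c * of_real (indicator (?E c) x))
        = (\<Sum>c\<in>range (S n). if c = S n x then indicator (ball 0 (real n)) x * c else 0)"
        by (intro sum.cong) (auto simp: indicator_def)
      also have "\<dots> = F n x" using fin by (simp add: F_def)
      finally show ?thesis by simp
    qed
    then have eq: "F n = (\<lambda>x. \<Sum>c\<in>range (S n). c * of_real (indicator (?E c) x))" by blast
    have [measurable]: "?E c \<in> sets borel" for c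
      using measurable_sets[of "S n" borel borel "{c}"] by auto
    show "continuous_on UNIV (mod_conv (F n) g)"
      unfolding eq
      by (subst mod_conv_sum[OF fin _ g])
         (auto intro!: continuous_intros mod_conv_continuous_indicator[of _ n] g indicator_square_integrable[of _ n])
  next
    have "(\<lambda>n. \<integral>x. (cmod (f x - F n x))\<^sup>2 \<partial>lborel) \<longlonglongrightarrow> (\<integral>x. 0 \<partial>(lborel :: 'a measure))"
    proof (rule integral_dominated_convergence)
      show "integrable lborel (\<lambda>x. 9 * (cmod (f x))\<^sup>2)" using f by (simp add: square_integrable_def)
      show "AE x in lborel. (\<lambda>n. (cmod (f x - F n x))\<^sup>2) \<longlonglongrightarrow> 0"
      proof (rule AE_I2)
        fix x :: 'a
        obtain m :: nat where m: "norm x < m" using reals_Archimedean2 by blast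
        have "\<forall>\<^sub>F n in sequentially. S n x = F n x"
          unfolding eventually_sequentially using m by (intro exI[of _ m]) (auto simp: F_def)
        then have "(\<lambda>n. F n x) \<longlonglongrightarrow> f x"
          using S(2)[of x] by (simp add: tendsto_cong)
        then have "(\<lambda>n. (cmod (f x - F n x))\<^sup>2) \<longlonglongrightarrow> (cmod (f x - f x))\<^sup>2"
          by (intro tendsto_intros)
        then show "(\<lambda>n. (cmod (f x - F n x))\<^sup>2) \<longlonglongrightarrow> 0" by simp
      qed
      fix n
      show "AE x in lborel. norm ((cmod (f x - F n x))\<^sup>2) \<le> 9 * (cmod (f x))\<^sup>2"
      proof (rule AE_I2)
        fix x
        have "cmod (f x - F n x) \<le> 3 * cmod (f x)"
          using norm_triangle_ineq4[of "f x" "F n x"] F_le[of n x] by simp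
        then have "(cmod (f x - F n x))\<^sup>2 \<le> (3 * cmod (f x))\<^sup>2" by (intro power_mono) auto
        then show "norm ((cmod (f x - F n x))\<^sup>2) \<le> 9 * (cmod (f x))\<^sup>2" by simp
      qed
    qed measurable
    then show "(\<lambda>n. \<integral>x. (cmod (f x - F n x))\<^sup>2 \<partial>lborel) \<longlonglongrightarrow> 0" by simp
  qed
qed

section \<open>Gaussians and their Fourier transforms\<close>

text \<open>Normalised to have value 1 at 0: \<open>gauss (e q)\<close> serves as a regulariser that
  tends to 1 as \<open>e\<close> tends to 0. Up to a constant it is its own Fourier
  transform.\<close>

definition gauss :: "'a::euclidean_space \<Rightarrow> real" where
  "gauss x = exp (- (norm x)\<^sup>2 / 2)"

lemma gauss_pos [simp]: "0 < gauss x" and gauss_le_1 [simp]: "gauss x \<le> 1"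
  by (auto simp: gauss_def)

lemma gauss_nonneg [simp]: "0 \<le> gauss x"
  by (simp add: gauss_def)

lemma gauss_0 [simp]: "gauss 0 = 1"
  by (simp add: gauss_def)

lemma continuous_on_gauss [continuous_intros]:
  "continuous_on A h \<Longrightarrow> continuous_on A (\<lambda>x. gauss (h x))"
  unfolding gauss_def by (intro continuous_intros) auto

lemma borel_measurable_gauss [measurable]: "gauss \<in> borel_measurable borel"
  by (intro borel_measurable_continuous_onI continuous_intros)

text \<open>This is the characteristic function of the standard normal distribution, rescaled by
  \<open>sqrt (2 * pi)\<close>.\<close>

lemma gauss_fourier_real:
  fixes t :: real
  shows "integrable lborel (\<lambda>x::real. complex_of_real (exp (- x\<^sup>2 / 2)) * cis (- (t * x)))"
    and "(\<integral>x. complex_of_real (exp (- x\<^sup>2 / 2)) * cis (- (t * x)) \<partial>lborel)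
      = complex_of_real (sqrt (2 * pi) * exp (- t\<^sup>2 / 2))"
proof -
  have eq: "complex_of_real (exp (- x\<^sup>2 / 2)) * cis (- (t * x))
    = sqrt (2 * pi) *\<^sub>R (std_normal_density x *\<^sub>R iexp (- t * x))" for x
    by (simp add: std_normal_density_def cis_conv_exp scaleR_conv_of_real mult_ac)
  have "integrable lborel (\<lambda>x. std_normal_density x *\<^sub>R iexp (- t * x))"
    by (rule Bochner_Integration.integrable_bound[OF integrable_normal_moment[of 1 0 0]]) auto
  then show "integrable lborel (\<lambda>x::real. complex_of_real (exp (- x\<^sup>2 / 2)) * cis (- (t * x)))"
    unfolding eq by (rule integrable_scaleR_right)
  have "(\<integral>x. std_normal_density x *\<^sub>R iexp (- t * x) \<partial>lborel) = char std_normal_distribution (- t)"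
    unfolding char_def by (subst integral_density) auto
  also have "\<dots> = complex_of_real (exp (- t\<^sup>2 / 2))"
    by (simp add: char_std_normal_distribution)
  finally show "(\<integral>x. complex_of_real (exp (- x\<^sup>2 / 2)) * cis (- (t * x)) \<partial>lborel)
      = complex_of_real (sqrt (2 * pi) * exp (- t\<^sup>2 / 2))"
    unfolding eq by (simp add: scaleR_conv_of_real)
qed

text \<open>The integrand is a product over the coordinates of one-dimensional integrands, so both
  claims reduce to the product measure over \<open>Basis\<close>.\<close>

lemma gauss_fourier:
  fixes v :: "'a::euclidean_space"
  shows "integrable lborel (\<lambda>x. complex_of_real (gauss x) * cis (- (x \<bullet> v)))"
    and "(\<integral>x. complex_of_real (gauss x) * cis (- (x \<bullet> v)) \<partial>lborel)
      = complex_of_real (sqrt (2 * pi) ^ DIM('a) * gauss v)"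
proof -
  interpret product_sigma_finite "\<lambda>_::'a. lborel :: real measure" by standard
  let ?h = "\<lambda>b x. complex_of_real (exp (- x\<^sup>2 / 2)) * cis (- ((v \<bullet> b) * x))"
  let ?T = "\<lambda>f. \<Sum>b\<in>Basis. f b *\<^sub>R b :: 'a"
  have h_exp: "?h b x = exp (complex_of_real (- x\<^sup>2 / 2) + \<i> * complex_of_real (- ((v \<bullet> b) * x)))" for b x
    by (simp only: exp_add cis_conv_exp exp_of_real)
  have prod: "complex_of_real (gauss x) * cis (- (x \<bullet> v)) = (\<Prod>b\<in>Basis. ?h b (x \<bullet> b))" for x
  proof -
    have "complex_of_real (gauss x) * cis (- (x \<bullet> v))
      = exp (complex_of_real (- (norm x)\<^sup>2 / 2) + \<i> * complex_of_real (- (x \<bullet> v)))"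
      by (simp only: gauss_def exp_add cis_conv_exp exp_of_real)
    also have "complex_of_real (- (norm x)\<^sup>2 / 2) + \<i> * complex_of_real (- (x \<bullet> v))
      = (\<Sum>b\<in>Basis. complex_of_real (- (x \<bullet> b)\<^sup>2 / 2) + \<i> * complex_of_real (- ((v \<bullet> b) * (x \<bullet> b))))"
      unfolding sum.distrib sum_distrib_left[symmetric] of_real_sum[symmetric]
      unfolding power2_norm_eq_inner euclidean_inner[of x x] euclidean_inner[of x v]
      by (simp add: sum_negf sum_divide_distrib[symmetric] power2_eq_square mult.commute)
    finally show ?thesis by (simp only: exp_sum[OF finite_Basis] h_exp)
  qed
  have T: "?T \<in> measurable (Pi\<^sub>M Basis (\<lambda>_. lborel)) borel" by measurable
  have [measurable]: "(\<lambda>x::'a. complex_of_real (gauss x) * cis (- (x \<bullet> v))) \<in> borel_measurable borel"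
    by measurable
  have comp: "complex_of_real (gauss (?T f)) * cis (- (?T f \<bullet> v)) = (\<Prod>b\<in>Basis. ?h b (f b))" for f
    unfolding prod by (intro prod.cong refl) simp
  have int: "integrable (Pi\<^sub>M Basis (\<lambda>_. lborel)) (\<lambda>f. \<Prod>b\<in>(Basis::'a set). ?h b (f b))"
    by (intro product_integrable_prod gauss_fourier_real) auto
  show "integrable lborel (\<lambda>x. complex_of_real (gauss x) * cis (- (x \<bullet> v)))"
    by (subst lborel_eq, subst integrable_distr_eq[OF T]) (use int in \<open>auto simp: comp\<close>)
  have "(\<integral>x. complex_of_real (gauss x) * cis (- (x \<bullet> v)) \<partial>lborel)
    = (\<integral>f. (\<Prod>b\<in>Basis. ?h b (f b)) \<partial>Pi\<^sub>M Basis (\<lambda>_. lborel))"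
    by (subst lborel_eq, subst integral_distr[OF T]) (auto simp: comp)
  also have "\<dots> = (\<Prod>b\<in>Basis. \<integral>x. ?h b x \<partial>lborel)"
    by (intro product_integral_prod gauss_fourier_real) auto
  also have "\<dots> = (\<Prod>b\<in>(Basis::'a set). complex_of_real (sqrt (2 * pi) * exp (- (v \<bullet> b)\<^sup>2 / 2)))"
    by (intro prod.cong refl gauss_fourier_real)
  also have "\<dots> = complex_of_real (sqrt (2 * pi) ^ DIM('a) * gauss v)"
    unfolding of_real_prod[symmetric] prod.distrib exp_sum[OF finite_Basis, symmetric] gauss_def
      power2_norm_eq_inner euclidean_inner[of v v]
    by (simp add: sum_negf sum_divide_distrib[symmetric] power2_eq_square)
  finally show "(\<integral>x. complex_of_real (gauss x) * cis (- (x \<bullet> v)) \<partial>lborel)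
      = complex_of_real (sqrt (2 * pi) ^ DIM('a) * gauss v)" .
qed

lemma integrable_gauss: "integrable lborel (gauss :: 'a::euclidean_space \<Rightarrow> real)"
  using integrable_norm[OF gauss_fourier(1)[of "0::'a"]] by simp

lemma integral_gauss: "(\<integral>x. gauss x \<partial>(lborel :: 'a::euclidean_space measure)) = sqrt (2 * pi) ^ DIM('a)"
proof -
  have "complex_of_real (\<integral>x. gauss x \<partial>(lborel :: 'a measure)) = of_real (sqrt (2 * pi) ^ DIM('a))"
    using gauss_fourier(2)[of "0::'a"] by simp
  then show ?thesis by (simp only: of_real_eq_iff)
qed

lemma gauss_fourier_scaled:
  fixes v :: "'a::euclidean_space"
  assumes e: "e > 0"
  shows "(\<integral>q. complex_of_real (gauss (e *\<^sub>R q)) * cis (- (q \<bullet> v)) \<partial>lborel)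
      = complex_of_real ((sqrt (2 * pi) / e) ^ DIM('a) * gauss ((1 / e) *\<^sub>R v))"
proof -
  have "(\<integral>q. complex_of_real (gauss (e *\<^sub>R q)) * cis (- (q \<bullet> v)) \<partial>lborel)
    = (1 / e) ^ DIM('a) *\<^sub>R (\<integral>q. complex_of_real (gauss q) * cis (- (q \<bullet> ((1 / e) *\<^sub>R v))) \<partial>lborel)"
    using e by (subst integral_lborel_affine[where c="1/e" and t=0]) auto
  then show ?thesis
    unfolding gauss_fourier by (simp add: scaleR_conv_of_real power_divide)
qed

lemma integrable_gauss_scaled:
  "e \<noteq> 0 \<Longrightarrow> integrable lborel (\<lambda>q::'a::euclidean_space. gauss (e *\<^sub>R q))"
  using integrable_lborel_affine[OF integrable_gauss, of e 0] by simp

text \<open>Fubini, with the Gaussian making the double integral absolutely convergent. The map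
  \<open>\<phi>\<close> lets \<open>k\<close> live on another space than the frequencies: it will be
  applied to pairs \<open>(t, t')\<close> with \<open>\<phi>\<close> their difference.\<close>

lemma gauss_multiplication_formula:
  fixes k :: "'b::euclidean_space \<Rightarrow> complex" and \<phi> :: "'b \<Rightarrow> 'a::euclidean_space"
  assumes k: "integrable lborel k" and [measurable]: "\<phi> \<in> borel_measurable borel" and e: "e > 0"
  shows "(\<integral>q. complex_of_real (gauss (e *\<^sub>R q)) * (\<integral>x. k x * cis (- (q \<bullet> \<phi> x)) \<partial>lborel) \<partial>lborel)
    = of_real ((sqrt (2 * pi) / e) ^ DIM('a)) * (\<integral>x. k x * of_real (gauss ((1 / e) *\<^sub>R \<phi> x)) \<partial>lborel)"
proof -
  have [measurable]: "k \<in> borel_measurable borel"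
    using borel_measurable_integrable[OF k] by simp
  let ?J = "\<lambda>(q::'a, x). complex_of_real (gauss (e *\<^sub>R q)) * (k x * cis (- (q \<bullet> \<phi> x)))"
  have J: "integrable (lborel \<Otimes>\<^sub>M lborel) ?J"
  proof (rule lborel_pair.Fubini_integrable)
    show "?J \<in> borel_measurable (lborel \<Otimes>\<^sub>M lborel)" by measurable
    have "(\<lambda>q::'a. \<integral>x. norm (?J (q, x)) \<partial>lborel) = (\<lambda>q. gauss (e *\<^sub>R q) * (\<integral>x. norm (k x) \<partial>lborel))"
      by (simp add: norm_mult)
    then show "integrable lborel (\<lambda>q::'a. \<integral>x. norm (?J (q, x)) \<partial>lborel)"
      using e by (simp add: integrable_gauss_scaled)
    have "integrable lborel (\<lambda>x. k x * cis (- (q \<bullet> \<phi> x)))" for q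
      by (rule Bochner_Integration.integrable_bound[OF k]) (auto simp: norm_mult)
    then show "AE q in lborel. integrable lborel (\<lambda>x. ?J (q, x))" by simp
  qed
  have "(\<integral>q. complex_of_real (gauss (e *\<^sub>R q)) * (\<integral>x. k x * cis (- (q \<bullet> \<phi> x)) \<partial>lborel) \<partial>lborel)
    = (\<integral>q. (\<integral>x. ?J (q, x) \<partial>lborel) \<partial>lborel)" by simp
  also have "\<dots> = (\<integral>x. (\<integral>q. ?J (q, x) \<partial>lborel) \<partial>lborel)"
    using lborel_pair.Fubini_integral[of "\<lambda>q x. ?J (q, x)"] J by simp
  also have "\<dots> = (\<integral>x. k x * (\<integral>q. complex_of_real (gauss (e *\<^sub>R q)) * cis (- (q \<bullet> \<phi> x)) \<partial>lborel) \<partial>lborel)"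
    by (simp add: mult_ac flip: integral_mult_right_zero)
  also have "\<dots> = (\<integral>x. of_real ((sqrt (2 * pi) / e) ^ DIM('a)) * (k x * of_real (gauss ((1 / e) *\<^sub>R \<phi> x))) \<partial>lborel)"
    unfolding gauss_fourier_scaled[OF e] by (simp add: mult_ac)
  finally show ?thesis by (simp only: integral_mult_right_zero)
qed

section \<open>A regularised Moyal identity\<close>

text \<open>Bilinear, with \<open>g\<close> not conjugated, so that the four functions in Moyal's
  identity can be chosen independently. The usual Wigner function of \<open>f\<close>, unnormalised,
  is the case where \<open>g\<close> is the conjugate of \<open>f\<close>.\<close>

definition cross_wigner :: "('a::euclidean_space \<Rightarrow> complex) \<Rightarrow> ('a \<Rightarrow> complex) \<Rightarrow> 'a \<times> 'a \<Rightarrow> complex" where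
  "cross_wigner f g = (\<lambda>(y, q). LINT t|lborel. f (y + t) * g (y - t) * cis (- (q \<bullet> t)))"

abbreviation conv :: "('a::euclidean_space \<Rightarrow> complex) \<Rightarrow> ('a \<Rightarrow> complex) \<Rightarrow> 'a \<Rightarrow> complex" where
  "conv f g s \<equiv> mod_conv f g (s, 0)"

lemma conv_eq: "conv f g s = (LINT u|lborel. f u * g (s - u))"
  by (simp add: mod_conv_def)

lemma conv_integrable:
  assumes "square_integrable f" "square_integrable g"
  shows "integrable lborel (\<lambda>u. f u * g (s - u))"
  using mod_conv_integrable[OF assms, of s 0] by simp

lemma cross_wigner_eq_mod_conv:
  "cross_wigner f g (y, q) = cis (q \<bullet> y) * mod_conv f g (2 *\<^sub>R y, q)"
proof -
  have "mod_conv f g (2 *\<^sub>R y, q) = (LINT t|lborel. f (y + t) * g (2 *\<^sub>R y - (y + t)) * cis (- (q \<bullet> (y + t))))"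
    unfolding mod_conv_def prod.case by (rule integral_lborel_translate[symmetric])
  also have "\<dots> = (LINT t|lborel. cis (- (q \<bullet> y)) * (f (y + t) * g (y - t) * cis (- (q \<bullet> t))))"
    by (intro Bochner_Integration.integral_cong refl)
       (simp add: inner_add_right scaleR_2 cis_mult algebra_simps)
  also have "\<dots> = cis (- (q \<bullet> y)) * cross_wigner f g (y, q)"
    by (simp only: cross_wigner_def prod.case integral_mult_right_zero)
  finally show ?thesis
    by (simp add: cis_mult flip: mult.assoc)
qed

lemma cross_wigner_continuous:
  assumes "square_integrable f" "square_integrable g"
  shows "continuous_on UNIV (cross_wigner f g)"
proof -
  have "cross_wigner f g = (\<lambda>z. cis (snd z \<bullet> fst z) * mod_conv f g (2 *\<^sub>R fst z, snd z))"
    using cross_wigner_eq_mod_conv by (auto simp: fun_eq_iff)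
  moreover have "continuous_on UNIV (\<lambda>z. cis (snd z \<bullet> fst z) * mod_conv f g (2 *\<^sub>R fst z, snd z))"
    unfolding cis_conv_exp
    by (intro continuous_intros continuous_on_compose2[OF mod_conv_continuous[OF assms]]) auto
  ultimately show ?thesis by simp
qed

lemma cross_wigner_integrable:
  assumes "square_integrable f" "square_integrable g"
  shows "integrable lborel (\<lambda>t. f (y + t) * g (y - t))"
  by (intro integrable_mult_square_integrable square_integrable_translate square_integrable_reflect assms)

lemma norm_mod_conv_bound:
  assumes "square_integrable f" "square_integrable g"
  obtains B where "B \<ge> 0" "\<And>z. cmod (mod_conv f g z) \<le> B"
proof
  show "0 \<le> (\<integral>x. (cmod (f x))\<^sup>2 \<partial>lborel) / 1 + 1 * (\<integral>x. (cmod (g x))\<^sup>2 \<partial>lborel)" by simp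
qed (rule norm_mod_conv_le[OF assms zero_less_one])

lemma norm_cross_wigner: "cmod (cross_wigner f g (y, q)) = cmod (mod_conv f g (2 *\<^sub>R y, q))"
  by (simp add: cross_wigner_eq_mod_conv norm_mult)

lemma integrable_lborel_times:
  fixes a :: "'a::euclidean_space \<Rightarrow> complex" and b :: "'b::euclidean_space \<Rightarrow> complex"
  assumes a: "integrable lborel a" and b: "integrable lborel b"
  shows "integrable lborel (\<lambda>p. a (fst p) * b (snd p))"
proof -
  have [measurable]: "a \<in> borel_measurable borel" "b \<in> borel_measurable borel"
    using borel_measurable_integrable[OF a] borel_measurable_integrable[OF b] by simp_all
  have "integrable (lborel \<Otimes>\<^sub>M lborel) (\<lambda>p. a (fst p) * b (snd p))"
    by (rule lborel_pair.Fubini_integrable) (use a b in \<open>auto simp: norm_mult\<close>)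
  then show ?thesis by (simp add: lborel_prod)
qed

lemma integral_lborel_times:
  fixes a :: "'a::euclidean_space \<Rightarrow> complex" and b :: "'b::euclidean_space \<Rightarrow> complex"
  assumes a: "integrable lborel a" and b: "integrable lborel b"
  shows "(\<integral>x. a x \<partial>lborel) * (\<integral>x. b x \<partial>lborel) = (\<integral>p. a (fst p) * b (snd p) \<partial>lborel)"
proof -
  have "integrable (lborel \<Otimes>\<^sub>M lborel) (\<lambda>p. a (fst p) * b (snd p))"
    using integrable_lborel_times[OF a b] by (simp add: lborel_prod)
  from lborel_pair.integral_fst'[OF this] show ?thesis
    by (simp add: lborel_prod)
qed

text \<open>For each \<open>w\<close> the L1 norm in \<open>u\<close> of the product is at most a
  constant independent of \<open>w\<close>, and the Gaussian takes care of the integral over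
  \<open>w\<close>.\<close>

lemma gauss_conv_integrable:
  assumes f: "square_integrable f" and g: "square_integrable g"
  shows "integrable (lborel \<Otimes>\<^sub>M lborel)
    (\<lambda>(u, w). complex_of_real (gauss (w::'a::euclidean_space)) * (f u * g (e *\<^sub>R w - u)))"
proof -
  have [measurable]: "f \<in> borel_measurable borel" "g \<in> borel_measurable borel"
    using f g by (auto simp: square_integrable_def)
  let ?C = "(\<integral>x. (cmod (f x))\<^sup>2 \<partial>lborel) / 1 + 1 * (\<integral>x. (cmod (g x))\<^sup>2 \<partial>lborel)"
  let ?H = "\<lambda>(w::'a, u). complex_of_real (gauss w) * (f u * g (e *\<^sub>R w - u))"
  have H: "integrable (lborel \<Otimes>\<^sub>M lborel) ?H"
  proof (rule lborel_pair.Fubini_integrable)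
    show "?H \<in> borel_measurable (lborel \<Otimes>\<^sub>M lborel)" by measurable
    show "AE w in lborel. integrable lborel (\<lambda>u. ?H (w, u))"
      using conv_integrable[OF f g] by simp
    show "integrable lborel (\<lambda>w. \<integral>u. cmod (?H (w, u)) \<partial>lborel)"
    proof (rule Bochner_Integration.integrable_bound)
      show "integrable lborel (\<lambda>w::'a. gauss w * ?C)"
        by (intro integrable_mult_left integrable_gauss)
      show "AE w in lborel. norm (\<integral>u. cmod (?H (w, u)) \<partial>lborel) \<le> norm (gauss w * ?C)"
      proof (rule AE_I2)
        fix w :: 'a
        have "(\<integral>u. cmod (f u * g (e *\<^sub>R w - u)) \<partial>lborel) \<le>
          (\<integral>x. (cmod (f x))\<^sup>2 \<partial>lborel) / 1 + 1 * (\<integral>x. (cmod (g (e *\<^sub>R w - x)))\<^sup>2 \<partial>lborel)"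
          by (intro integral_norm_mult_le f g square_integrable_reflect) simp
        also have "(\<integral>x. (cmod (g (e *\<^sub>R w - x)))\<^sup>2 \<partial>lborel) = (\<integral>x. (cmod (g x))\<^sup>2 \<partial>lborel)"
          by (rule integral_lborel_reflect)
        finally have "gauss w * (\<integral>u. cmod (f u * g (e *\<^sub>R w - u)) \<partial>lborel) \<le> gauss w * ?C"
          by (intro mult_left_mono) auto
        moreover have "(\<integral>u. cmod (?H (w, u)) \<partial>lborel) = gauss w * (\<integral>u. cmod (f u * g (e *\<^sub>R w - u)) \<partial>lborel)"
          by (simp add: norm_mult)
        moreover have "0 \<le> gauss w * (\<integral>u. cmod (f u * g (e *\<^sub>R w - u)) \<partial>lborel)"
          by (intro mult_nonneg_nonneg) auto
        ultimately show "norm (\<integral>u. cmod (?H (w, u)) \<partial>lborel) \<le> norm (gauss w * ?C)"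
          unfolding real_norm_def by linarith
      qed
    qed measurable
  qed
  from lborel_pair.integrable_product_swap[OF this] show ?thesis
    by simp
qed

section \<open>The kernel of the regularised Moyal integral and its two orders of
  integration\<close>

context
  fixes f1 f2 f3 f4 :: "'a::euclidean_space \<Rightarrow> complex" and e :: real
  assumes f1: "square_integrable f1" and f2: "square_integrable f2"
    and f3: "square_integrable f3" and f4: "square_integrable f4" and e: "e > 0"
begin

lemma moyal_measurable [measurable]:
  "f1 \<in> borel_measurable borel" "f2 \<in> borel_measurable borel"
  "f3 \<in> borel_measurable borel" "f4 \<in> borel_measurable borel"
  using f1 f2 f3 f4 by (auto simp: square_integrable_def)

text \<open>
  The integrand of the regularised Moyal integral in the coordinates \<open>u = y + t\<close> and
  \<open>e w = t - t'\<close>, where \<open>t\<close> and \<open>t'\<close> are the integration variables of the two Wigner functions;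
  substituting also \<open>2 y - u\<close> for \<open>y\<close> makes the integrals over \<open>u\<close> and \<open>y\<close> factor.
\<close>

definition moyal_kernel :: "('a \<times> 'a) \<Rightarrow> 'a \<Rightarrow> complex" where
  "moyal_kernel = (\<lambda>(u, w) y. (of_real (gauss w) * (f1 u * f4 (e *\<^sub>R w - u))) * (f2 (2 *\<^sub>R y - u) * f3 (u - 2 *\<^sub>R y - e *\<^sub>R w)))"

text \<open>The substitution \<open>z = 2 y - u\<close> removes \<open>u\<close>: the integral over
  \<open>y\<close> depends on \<open>w\<close> alone, and the Jacobian contributes the power of
  \<open>1 / 2\<close>.\<close>

lemma moyal_kernel_inner:
  "integrable lborel (\<lambda>y. f2 (2 *\<^sub>R y - u) * f3 (u - 2 *\<^sub>R y - e *\<^sub>R w))"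
  "(\<integral>y. f2 (2 *\<^sub>R y - u) * f3 (u - 2 *\<^sub>R y - e *\<^sub>R w) \<partial>lborel)
    = (1 / 2) ^ DIM('a) * conv f2 f3 (- (e *\<^sub>R w))"
  "(\<integral>y. cmod (f2 (2 *\<^sub>R y - u) * f3 (u - 2 *\<^sub>R y - e *\<^sub>R w)) \<partial>lborel)
    = (1 / 2) ^ DIM('a) * (\<integral>z. cmod (f2 z * f3 (- (e *\<^sub>R w) - z)) \<partial>lborel)"
proof -
  let ?h = "\<lambda>z. f2 z * f3 (- (e *\<^sub>R w) - z)"
  have arg: "u - 2 *\<^sub>R y - e *\<^sub>R w = - (e *\<^sub>R w) - (- u + 2 *\<^sub>R y)" "2 *\<^sub>R y - u = - u + 2 *\<^sub>R y" for y
    by (auto simp: algebra_simps)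
  show "integrable lborel (\<lambda>y. f2 (2 *\<^sub>R y - u) * f3 (u - 2 *\<^sub>R y - e *\<^sub>R w))"
    unfolding arg by (rule integrable_lborel_affine[of ?h]) (auto intro: conv_integrable f2 f3)
  show "(\<integral>y. f2 (2 *\<^sub>R y - u) * f3 (u - 2 *\<^sub>R y - e *\<^sub>R w) \<partial>lborel)
    = (1 / 2) ^ DIM('a) * conv f2 f3 (- (e *\<^sub>R w))"
    unfolding arg conv_eq integral_lborel_affine[of 2 ?h "-u", simplified]
    by (simp add: scaleR_conv_of_real power_divide)
  show "(\<integral>y. cmod (f2 (2 *\<^sub>R y - u) * f3 (u - 2 *\<^sub>R y - e *\<^sub>R w)) \<partial>lborel)
    = (1 / 2) ^ DIM('a) * (\<integral>z. cmod (f2 z * f3 (- (e *\<^sub>R w) - z)) \<partial>lborel)"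
    unfolding arg integral_lborel_affine[of 2 "\<lambda>z. cmod (?h z)" "-u", simplified]
    by (simp add: power_divide)
qed

text \<open>The L1 norms over \<open>y\<close> are bounded by a constant multiple of the modulus of
  the factor in \<open>(u, w)\<close>, which is integrable by
  \<open>gauss_conv_integrable\<close>.\<close>

lemma moyal_kernel_integrable:
  "integrable (lborel \<Otimes>\<^sub>M lborel) (\<lambda>(p, y). moyal_kernel p y)"
proof (rule lborel_pair.Fubini_integrable)
  have meas: "(\<lambda>p::('a \<times> 'a) \<times> 'a. moyal_kernel (fst p) (snd p)) \<in> borel_measurable borel"
    unfolding borel_prod[symmetric] moyal_kernel_def split_beta by measurable
  then show "(\<lambda>(p, y). moyal_kernel p y) \<in> borel_measurable (lborel \<Otimes>\<^sub>M lborel)"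
    by (simp add: split_beta lborel_prod)
  show "AE p in lborel. integrable lborel (\<lambda>y. case (p, y) of (p, y) \<Rightarrow> moyal_kernel p y)"
    by (auto simp: moyal_kernel_def split_beta intro!: moyal_kernel_inner)
  let ?C = "(\<integral>x. (cmod (f2 x))\<^sup>2 \<partial>lborel) / 1 + 1 * (\<integral>x. (cmod (f3 x))\<^sup>2 \<partial>lborel)"
  let ?g = "\<lambda>(u, w). complex_of_real (gauss w) * (f1 u * f4 (e *\<^sub>R w - u))"
  have g: "integrable lborel ?g"
    using gauss_conv_integrable[OF f1 f4, of e] by (simp add: lborel_prod)
  show "integrable lborel (\<lambda>p. \<integral>y. cmod (case (p, y) of (p, y) \<Rightarrow> moyal_kernel p y) \<partial>lborel)"
  proof (rule Bochner_Integration.integrable_bound)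
    show "integrable lborel (\<lambda>p. cmod (?g p) * ((1 / 2) ^ DIM('a) * ?C))"
      using integrable_norm[OF g] by (rule integrable_mult_left)
    have [measurable]: "(\<lambda>p::('a \<times> 'a) \<times> 'a. moyal_kernel (fst p) (snd p)) \<in> borel_measurable (lborel \<Otimes>\<^sub>M lborel)"
      using meas by (simp add: lborel_prod)
    show "(\<lambda>p. \<integral>y. cmod (case (p, y) of (p, y) \<Rightarrow> moyal_kernel p y) \<partial>lborel) \<in> borel_measurable lborel"
      using lborel.borel_measurable_lebesgue_integral[of "\<lambda>p y. cmod (moyal_kernel p y)" lborel]
      by (simp add: split_beta)
    show "AE p in lborel. norm (\<integral>y. cmod (case (p, y) of (p, y) \<Rightarrow> moyal_kernel p y) \<partial>lborel)
      \<le> norm (cmod (?g p) * ((1 / 2) ^ DIM('a) * ?C))"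
    proof (rule AE_I2)
      fix p :: "'a \<times> 'a"
      obtain u w where p: "p = (u, w)" by force
      have "(\<integral>z. cmod (f2 z * f3 (- (e *\<^sub>R w) - z)) \<partial>lborel)
        \<le> (\<integral>x. (cmod (f2 x))\<^sup>2 \<partial>lborel) / 1 + 1 * (\<integral>x. (cmod (f3 (- (e *\<^sub>R w) - x)))\<^sup>2 \<partial>lborel)"
        by (intro integral_norm_mult_le f2 f3 square_integrable_reflect) simp
      also have "(\<integral>x. (cmod (f3 (- (e *\<^sub>R w) - x)))\<^sup>2 \<partial>lborel) = (\<integral>x. (cmod (f3 x))\<^sup>2 \<partial>lborel)"
        by (rule integral_lborel_reflect)
      finally have le: "(\<integral>z. cmod (f2 z * f3 (- (e *\<^sub>R w) - z)) \<partial>lborel) \<le> ?C" .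
      have "(\<integral>y. cmod (moyal_kernel (u, w) y) \<partial>lborel)
        = cmod (?g (u, w)) * (\<integral>y. cmod (f2 (2 *\<^sub>R y - u) * f3 (u - 2 *\<^sub>R y - e *\<^sub>R w)) \<partial>lborel)"
        unfolding moyal_kernel_def prod.case norm_mult[of "complex_of_real (gauss w) * (f1 u * f4 (e *\<^sub>R w - u))"]
        by (rule integral_mult_right_zero)
      also have "\<dots> \<le> cmod (?g (u, w)) * ((1 / 2) ^ DIM('a) * ?C)"
        unfolding moyal_kernel_inner by (intro mult_left_mono le) auto
      finally have *: "(\<integral>y. cmod (moyal_kernel (u, w) y) \<partial>lborel) \<le> cmod (?g (u, w)) * ((1 / 2) ^ DIM('a) * ?C)" .
      show "norm (\<integral>y. cmod (case (p, y) of (p, y) \<Rightarrow> moyal_kernel p y) \<partial>lborel)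
      \<le> norm (cmod (?g p) * ((1 / 2) ^ DIM('a) * ?C))"
        unfolding real_norm_def prod.case p
        by (rule order_trans[OF _ abs_ge_self]) (use * in \<open>simp add: abs_of_nonneg\<close>)
    qed
  qed
qed

text \<open>For fixed \<open>y\<close> the product of the two Wigner functions is one oscillatory
  integral over \<open>(t, t')\<close> with phase in \<open>t - t'\<close>. The multiplication
  formula replaces the integral over \<open>q\<close> by a Gaussian in
  \<open>(t - t') / e\<close>.\<close>

lemma moyal_slice:
  "(\<integral>q. complex_of_real (gauss (e *\<^sub>R q)) * (cross_wigner f1 f2 (y, q) * cross_wigner f3 f4 (- y, - q)) \<partial>lborel)
    = of_real (sqrt (2 * pi) ^ DIM('a)) * (\<integral>u. (\<integral>w. moyal_kernel (u, w) y \<partial>lborel) \<partial>lborel)"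
proof -
  let ?a = "\<lambda>t. f1 (y + t) * f2 (y - t)" and ?b = "\<lambda>t. f3 (- y + t) * f4 (- y - t)"
  let ?k = "\<lambda>p. ?a (fst p) * ?b (snd p)"
  let ?\<phi> = "\<lambda>p::'a \<times> 'a. fst p - snd p"
  let ?G = "\<lambda>p. of_real (gauss ((1 / e) *\<^sub>R ?\<phi> p))"
  have a: "integrable lborel ?a" and b: "integrable lborel ?b"
    by (intro cross_wigner_integrable f1 f2 f3 f4)+
  have k: "integrable lborel ?k"
    by (rule integrable_lborel_times[OF a b])
  have prod: "cross_wigner f1 f2 (y, q) * cross_wigner f3 f4 (- y, - q)
    = (\<integral>p. ?k p * cis (- (q \<bullet> ?\<phi> p)) \<partial>lborel)" for q
  proof -
    have "integrable lborel (\<lambda>t. ?a t * cis (- (q \<bullet> t)))" "integrable lborel (\<lambda>t. ?b t * cis (q \<bullet> t))"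
      by (rule Bochner_Integration.integrable_bound[OF a], simp, simp add: norm_mult)
         (rule Bochner_Integration.integrable_bound[OF b], simp, simp add: norm_mult)
    from integral_lborel_times[OF this]
    have "cross_wigner f1 f2 (y, q) * cross_wigner f3 f4 (- y, - q)
      = (\<integral>p. ?a (fst p) * cis (- (q \<bullet> fst p)) * (?b (snd p) * cis (q \<bullet> snd p)) \<partial>lborel)"
      by (simp add: cross_wigner_def)
    also have "\<dots> = (\<integral>p. ?k p * cis (- (q \<bullet> ?\<phi> p)) \<partial>lborel)"
    proof (intro Bochner_Integration.integral_cong refl)
      fix p :: "'a \<times> 'a"
      have "cis (- (q \<bullet> ?\<phi> p)) = cis (- (q \<bullet> fst p)) * cis (q \<bullet> snd p)"
        by (simp add: cis_mult inner_diff_right)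
      then show "?a (fst p) * cis (- (q \<bullet> fst p)) * (?b (snd p) * cis (q \<bullet> snd p)) = ?k p * cis (- (q \<bullet> ?\<phi> p))"
        by (simp add: mult_ac)
    qed
    finally show ?thesis .
  qed
  have kG: "integrable (lborel \<Otimes>\<^sub>M lborel) (\<lambda>p. ?k p * ?G p)"
    unfolding lborel_prod
  proof (rule Bochner_Integration.integrable_bound[OF k])
    have "(\<lambda>p::'a \<times> 'a. complex_of_real (gauss ((1 / e) *\<^sub>R (fst p - snd p)))) \<in> borel_measurable borel"
      by (intro borel_measurable_continuous_onI continuous_intros)
    then show "(\<lambda>p. ?k p * ?G p) \<in> borel_measurable lborel"
      by (intro borel_measurable_times[OF borel_measurable_integrable[OF k]]) simp
  qed (auto simp: norm_mult intro!: mult_left_le)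
  have "(\<integral>p. ?k p * ?G p \<partial>lborel) = (\<integral>t. (\<integral>t'. ?k (t, t') * ?G (t, t') \<partial>lborel) \<partial>lborel)"
    using lborel_pair.integral_fst'[OF kG] by (simp add: lborel_prod)
  also have "\<dots> = (\<integral>t. e ^ DIM('a) *\<^sub>R (\<integral>w. ?k (t, t - e *\<^sub>R w) * of_real (gauss w) \<partial>lborel) \<partial>lborel)"
  proof (intro Bochner_Integration.integral_cong refl)
    fix t :: 'a
    show "(\<integral>t'. ?k (t, t') * ?G (t, t') \<partial>lborel)
      = e ^ DIM('a) *\<^sub>R (\<integral>w. ?k (t, t - e *\<^sub>R w) * of_real (gauss w) \<partial>lborel)"
      \<comment> \<open>The substitution \<open>t' = t - e w\<close>; its Jacobian later cancels the
        power of \<open>1 / e\<close> from the multiplication formula.\<close>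
      using e by (subst integral_lborel_affine[where c="-e" and t=t]) auto
  qed
  also have "\<dots> = e ^ DIM('a) *\<^sub>R (\<integral>t. (\<integral>w. ?k (t, t - e *\<^sub>R w) * of_real (gauss w) \<partial>lborel) \<partial>lborel)"
    by simp
  also have "(\<integral>t. (\<integral>w. ?k (t, t - e *\<^sub>R w) * of_real (gauss w) \<partial>lborel) \<partial>lborel)
    = (\<integral>u. (\<integral>w. ?k (- y + u, - y + u - e *\<^sub>R w) * of_real (gauss w) \<partial>lborel) \<partial>lborel)"
    by (rule integral_lborel_translate[symmetric])
  also have "\<dots> = (\<integral>u. (\<integral>w. moyal_kernel (u, w) y \<partial>lborel) \<partial>lborel)"
    by (simp add: moyal_kernel_def algebra_simps scaleR_2)
  finally have kG_eq: "(\<integral>p. ?k p * ?G p \<partial>lborel)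
    = e ^ DIM('a) *\<^sub>R (\<integral>u. (\<integral>w. moyal_kernel (u, w) y \<partial>lborel) \<partial>lborel)" .
  have \<phi>: "?\<phi> \<in> borel_measurable borel"
    by (intro borel_measurable_continuous_onI continuous_intros)
  show ?thesis
    unfolding prod gauss_multiplication_formula[OF k \<phi> e] kG_eq
    using e by (simp add: scaleR_conv_of_real power_divide)
qed

text \<open>Fubini with \<open>y\<close> integrated first: that integral collapses to a convolution
  of \<open>f2\<close> and \<open>f3\<close>, after which the integral over \<open>u\<close> gives
  one of \<open>f1\<close> and \<open>f4\<close>.\<close>

lemma moyal_regularized:
  "integrable lborel (\<lambda>y. \<integral>q. complex_of_real (gauss (e *\<^sub>R q)) *
      (cross_wigner f1 f2 (y, q) * cross_wigner f3 f4 (- y, - q)) \<partial>lborel)" (is ?I)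
  "(\<integral>y. (\<integral>q. complex_of_real (gauss (e *\<^sub>R q)) *
      (cross_wigner f1 f2 (y, q) * cross_wigner f3 f4 (- y, - q)) \<partial>lborel) \<partial>lborel)
    = of_real ((sqrt (2 * pi) / 2) ^ DIM('a)) *
      (\<integral>w. of_real (gauss w) * (conv f1 f4 (e *\<^sub>R w) * conv f2 f3 (- (e *\<^sub>R w))) \<partial>lborel)" (is ?E)
proof -
  let ?L = "\<lambda>y. \<integral>q. complex_of_real (gauss (e *\<^sub>R q)) *
      (cross_wigner f1 f2 (y, q) * cross_wigner f3 f4 (- y, - q)) \<partial>lborel"
  let ?R = "\<lambda>y. of_real (sqrt (2 * pi) ^ DIM('a)) * (\<integral>p. moyal_kernel p y \<partial>lborel)"
  have R: "integrable lborel ?R"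
    using lborel_pair.integrable_snd[OF moyal_kernel_integrable] by (rule integrable_mult_right)
  \<comment> \<open>Fubini yields integrable slices of the kernel only for almost every
    \<open>y\<close>, so the slice formula meets the joint integral almost everywhere.\<close>
  have LR: "AE y in lborel. ?L y = ?R y"
    using lborel_pair.AE_integrable_snd[OF moyal_kernel_integrable]
  proof eventually_elim
    case (elim y)
    then have "integrable (lborel \<Otimes>\<^sub>M lborel) (\<lambda>p. moyal_kernel p y)"
      by (simp add: lborel_prod)
    from lborel_pair.integral_fst'[OF this] show ?case
      unfolding moyal_slice by (simp add: lborel_prod)
  qed
  have "continuous_on UNIV (\<lambda>p. complex_of_real (gauss (e *\<^sub>R snd p)) *
      (cross_wigner f1 f2 (fst p, snd p) * cross_wigner f3 f4 (- fst p, - snd p)))"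
    by (intro continuous_intros continuous_on_compose2[OF cross_wigner_continuous[OF f1 f2]]
         continuous_on_compose2[OF cross_wigner_continuous[OF f3 f4]]) auto
  then have "(\<lambda>(y, q). complex_of_real (gauss (e *\<^sub>R q)) *
      (cross_wigner f1 f2 (y, q) * cross_wigner f3 f4 (- y, - q))) \<in> borel_measurable (lborel \<Otimes>\<^sub>M lborel)"
    by (simp add: lborel_prod split_beta borel_measurable_continuous_onI)
  then have L: "?L \<in> borel_measurable lborel"
    by (rule lborel.borel_measurable_lebesgue_integral)
  show ?I
    by (rule integrable_cong_AE_imp[OF R L]) (use LR in auto)
  have "(\<integral>y. ?L y \<partial>lborel) = (\<integral>y. ?R y \<partial>lborel)"
    by (rule integral_cong_AE[OF L _ LR]) (use R in auto)
  also have "\<dots> = of_real (sqrt (2 * pi) ^ DIM('a)) * (\<integral>y. (\<integral>p. moyal_kernel p y \<partial>lborel) \<partial>lborel)"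
    by (rule integral_mult_right_zero)
  also have "(\<integral>y. (\<integral>p. moyal_kernel p y \<partial>lborel) \<partial>lborel) = (\<integral>p. (\<integral>y. moyal_kernel p y \<partial>lborel) \<partial>lborel)"
    by (rule lborel_pair.Fubini_integral[OF moyal_kernel_integrable])
  also have "\<dots> = (\<integral>(u, w). of_real (gauss w) * (f1 u * f4 (e *\<^sub>R w - u)) *
       ((1 / 2) ^ DIM('a) * conv f2 f3 (- (e *\<^sub>R w))) \<partial>lborel)" (is "_ = (\<integral>p. ?H p \<partial>lborel)")
    by (intro Bochner_Integration.integral_cong refl)
       (auto simp: moyal_kernel_def moyal_kernel_inner(2))
  also have "\<dots> = (\<integral>w. (\<integral>u. ?H (u, w) \<partial>lborel) \<partial>lborel)"
  proof -
    obtain B where B: "B \<ge> 0" "\<And>z. cmod (mod_conv f2 f3 z) \<le> B"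
      using norm_mod_conv_bound[OF f2 f3] by metis
    have [measurable]: "conv f2 f3 \<in> borel_measurable borel"
      by (intro borel_measurable_continuous_onI continuous_on_compose2[OF mod_conv_continuous[OF f2 f3]] continuous_intros) auto
    have "integrable (lborel \<Otimes>\<^sub>M lborel) ?H"
    proof (rule Bochner_Integration.integrable_bound[OF integrable_mult_left[OF gauss_conv_integrable[OF f1 f4, of e], of "of_real ((1 / 2) ^ DIM('a) * B)"]])
      show "?H \<in> borel_measurable (lborel \<Otimes>\<^sub>M lborel)" by measurable
      show "AE x in lborel \<Otimes>\<^sub>M lborel. cmod (?H x) \<le> cmod ((case x of (u, w) \<Rightarrow> complex_of_real (gauss w) * (f1 u * f4 (e *\<^sub>R w - u))) * of_real ((1 / 2) ^ DIM('a) * B))"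
        using B by (intro AE_I2) (auto simp: norm_mult norm_power norm_divide abs_mult intro!: mult_left_mono)
    qed
    from lborel_pair.integral_snd[of "\<lambda>u w. ?H (u, w)"] this show ?thesis
      by (simp add: lborel_prod)
  qed
  also have "\<dots> = (\<integral>w. (1 / 2) ^ DIM('a) * (of_real (gauss w) * (conv f1 f4 (e *\<^sub>R w) * conv f2 f3 (- (e *\<^sub>R w)))) \<partial>lborel)"
  proof (intro Bochner_Integration.integral_cong refl)
    fix w :: 'a
    have "(\<integral>u. ?H (u, w) \<partial>lborel) = (\<integral>u. (f1 u * f4 (e *\<^sub>R w - u)) *
        ((1 / 2) ^ DIM('a) * (of_real (gauss w) * conv f2 f3 (- (e *\<^sub>R w)))) \<partial>lborel)"
      by (simp add: mult_ac)
    also have "\<dots> = conv f1 f4 (e *\<^sub>R w) * ((1 / 2) ^ DIM('a) * (of_real (gauss w) * conv f2 f3 (- (e *\<^sub>R w))))"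
      unfolding conv_eq[of f1] by (rule integral_mult_left_zero)
    finally show "(\<integral>u. ?H (u, w) \<partial>lborel)
      = (1 / 2) ^ DIM('a) * (of_real (gauss w) * (conv f1 f4 (e *\<^sub>R w) * conv f2 f3 (- (e *\<^sub>R w))))"
      by (simp add: mult_ac)
  qed
  finally show ?E by (simp add: power_divide mult_ac)
qed

end

section \<open>Moyal's identity\<close>

lemma gauss_scaleR_tendsto_1:
  assumes "(e \<longlongrightarrow> 0) F"
  shows "((\<lambda>n. gauss (e n *\<^sub>R w)) \<longlongrightarrow> 1) F"
proof -
  have "((\<lambda>n. exp (- (norm (e n *\<^sub>R w))\<^sup>2 / 2)) \<longlongrightarrow> exp (- (norm (0 *\<^sub>R w))\<^sup>2 / 2)) F"
    by (intro tendsto_intros assms) auto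
  then show ?thesis by (simp add: gauss_def)
qed

lemma norm_gauss_integral_le:
  fixes h :: "'a::euclidean_space \<Rightarrow> complex"
  assumes "\<And>w. cmod (h w) \<le> B"
  shows "cmod (\<integral>w. of_real (gauss w) * h w \<partial>lborel) \<le> B * sqrt (2 * pi) ^ DIM('a)"
proof -
  have B: "0 \<le> B" using assms[of 0] norm_ge_zero order_trans by blast
  have "cmod (\<integral>w. of_real (gauss w) * h w \<partial>lborel) \<le> (\<integral>w. cmod (of_real (gauss w) * h w) \<partial>lborel)"
    by (rule integral_norm_bound)
  also have "\<dots> \<le> (\<integral>w. gauss (w::'a) * B \<partial>lborel)"
    using assms B by (intro integral_mono') (auto simp: norm_mult intro!: integrable_gauss mult_left_mono)
  also have "\<dots> = B * sqrt (2 * pi) ^ DIM('a)"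
    by (simp add: integral_gauss)
  finally show ?thesis .
qed

lemma cross_wigner_borel_measurable:
  assumes "square_integrable f" "square_integrable g"
  shows "cross_wigner f g \<in> borel_measurable borel"
  by (intro borel_measurable_continuous_onI cross_wigner_continuous assms)

text \<open>
  This turns the regularised Moyal identity into a bound for \<open>\<integral> \<bar>X\<bar>\<^sup>2\<close> that is uniform in the regularisation.
\<close>

lemma cross_wigner_conj_reflect:
  "cross_wigner (\<lambda>x. cnj (g (- x))) (\<lambda>x. cnj (f (- x))) (- z) = cnj (cross_wigner f g z)"
proof -
  obtain y q where z: "z = (y, q)" by force
  have "cross_wigner (\<lambda>x. cnj (g (- x))) (\<lambda>x. cnj (f (- x))) (- z)
    = (LINT t|lborel. cnj (f (y + t) * g (y - t) * cis (- (q \<bullet> t))))"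
    unfolding z uminus_Pair cross_wigner_def prod.case
    by (intro Bochner_Integration.integral_cong refl) (simp add: cis_cnj add.commute mult_ac)
  also have "\<dots> = cnj (cross_wigner f g z)"
    unfolding z cross_wigner_def prod.case by (rule Bochner_Integration.integral_cnj)
  finally show ?thesis .
qed

text \<open>Fatou's lemma along \<open>e n\<close> tending to 0: the regularised Moyal identity for
  \<open>f\<close>, \<open>g\<close> and their reflected conjugates evaluates the damped integrals
  of the squared modulus, and these stay below a constant.\<close>

lemma cross_wigner_square_integrable:
  fixes f g :: "'a::euclidean_space \<Rightarrow> complex"
  assumes f: "square_integrable f" and g: "square_integrable g"
  shows "square_integrable (cross_wigner f g)"
proof -
  let ?X = "cross_wigner f g"
  let ?f4 = "\<lambda>x. cnj (f (- x))" and ?f3 = "\<lambda>x. cnj (g (- x))"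
  have f4: "square_integrable ?f4" and f3: "square_integrable ?f3"
    using square_integrable_cnj[OF square_integrable_reflect[OF f, of 0]]
      square_integrable_cnj[OF square_integrable_reflect[OF g, of 0]] by simp_all
  note [measurable] = cross_wigner_borel_measurable[OF f g]
  obtain B1 where B1: "B1 \<ge> 0" "\<And>z. cmod (mod_conv f ?f4 z) \<le> B1"
    using norm_mod_conv_bound[OF f f4] by metis
  obtain B2 where B2: "B2 \<ge> 0" "\<And>z. cmod (mod_conv g ?f3 z) \<le> B2"
    using norm_mod_conv_bound[OF g f3] by metis
  obtain B where B: "\<And>z. cmod (mod_conv f g z) \<le> B"
    using norm_mod_conv_bound[OF f g] by metis
  define e :: "nat \<Rightarrow> real" where "e n = inverse (real (Suc n))" for n
  have e: "e n > 0" for n by (simp add: e_def)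
  define u where "u n z = gauss (e n *\<^sub>R snd z) * (cmod (?X z))\<^sup>2" for n z
  \<comment> \<open>The prefactor of the regularised identity times the Gaussian mass times the sup
    bounds of the two convolutions; none of these depends on \<open>e n\<close>.\<close>
  define K where "K = (sqrt (2 * pi) / 2) ^ DIM('a) * (B1 * B2 * sqrt (2 * pi) ^ DIM('a))"
  have u_meas[measurable]: "u n \<in> borel_measurable borel" for n
    unfolding u_def
    by (intro borel_measurable_continuous_onI continuous_intros
        continuous_on_compose2[OF cross_wigner_continuous[OF f g]]) auto
  have u_nonneg: "u n z \<ge> 0" for n z by (simp add: u_def)
  have u_bound: "(\<integral>\<^sup>+z. ennreal (u n z) \<partial>lborel) \<le> ennreal K" for n
  proof -
    have cu: "complex_of_real (u n (y, q)) = complex_of_real (gauss (e n *\<^sub>R q)) * (?X (y, q) * cross_wigner ?f3 ?f4 (- y, - q))" for y q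
      using cross_wigner_conj_reflect[of g f "(y, q)"]
      by (simp only: u_def of_real_mult complex_norm_square snd_conv uminus_Pair)
    have int_q: "integrable lborel (\<lambda>q. u n (y, q))" for y
    proof (rule Bochner_Integration.integrable_bound)
      show "integrable lborel (\<lambda>q::'a. gauss (e n *\<^sub>R q) * B\<^sup>2)"
        using e[of n] by (intro integrable_mult_left integrable_gauss_scaled) simp
      have "(\<lambda>q. u n (y, q)) \<in> borel_measurable borel"
        using measurable_compose[OF _ u_meas[of n], of "\<lambda>q. (y, q)" borel]
        by (simp add: borel_measurable_continuous_onI continuous_intros)
      then show "(\<lambda>q. u n (y, q)) \<in> borel_measurable lborel" by simp
      show "AE q in lborel. norm (u n (y, q)) \<le> norm (gauss (e n *\<^sub>R q) * B\<^sup>2)"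
        using B by (intro AE_I2) (auto simp: u_def abs_mult norm_cross_wigner intro!: mult_left_mono power_mono)
    qed
    \<comment> \<open>The Gaussian damps only \<open>q\<close>; integrability in \<open>y\<close> is
      supplied by the regularised identity itself.\<close>
    have int_y: "integrable lborel (\<lambda>y. \<integral>q. u n (y, q) \<partial>lborel)"
      using integrable_Re[OF moyal_regularized(1)[OF f g f3 f4 e[of n]]]
      unfolding cu[symmetric] integral_complex_of_real by simp
    have "(\<integral>\<^sup>+z. ennreal (u n z) \<partial>lborel) = (\<integral>\<^sup>+y. (\<integral>\<^sup>+q. ennreal (u n (y, q)) \<partial>lborel) \<partial>lborel)"
      using lborel.nn_integral_fst[of "\<lambda>z. ennreal (u n z)" "lborel :: 'a measure"]
      by (simp add: lborel_prod)
    also have "\<dots> = (\<integral>\<^sup>+y. ennreal (\<integral>q. u n (y, q) \<partial>lborel) \<partial>lborel)"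
      by (intro nn_integral_cong nn_integral_eq_integral int_q) (auto simp: u_nonneg)
    also have "\<dots> = ennreal (\<integral>y. (\<integral>q. u n (y, q) \<partial>lborel) \<partial>lborel)"
      by (intro nn_integral_eq_integral int_y) (auto simp: u_nonneg)
    also have "\<dots> \<le> ennreal K"
    proof (rule ennreal_leI)
      have "(\<integral>y. (\<integral>q. u n (y, q) \<partial>lborel) \<partial>lborel)
        \<le> cmod (complex_of_real (\<integral>y. (\<integral>q. u n (y, q) \<partial>lborel) \<partial>lborel))"
        by simp
      also have "complex_of_real (\<integral>y. (\<integral>q. u n (y, q) \<partial>lborel) \<partial>lborel)
        = of_real ((sqrt (2 * pi) / 2) ^ DIM('a)) *
          (\<integral>w. of_real (gauss w) * (conv f ?f4 (e n *\<^sub>R w) * conv g ?f3 (- (e n *\<^sub>R w))) \<partial>lborel)"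
        using moyal_regularized(2)[OF f g f3 f4 e[of n]]
        unfolding cu[symmetric] integral_complex_of_real .
      also have "cmod \<dots> \<le> K"
        unfolding K_def norm_mult[of "of_real _"]
        by (intro mult_mono norm_gauss_integral_le)
           (use B1 B2 in \<open>auto simp: norm_mult norm_power norm_divide intro!: mult_mono\<close>)
      finally show "(\<integral>y. (\<integral>q. u n (y, q) \<partial>lborel) \<partial>lborel) \<le> K" .
    qed
    finally show ?thesis .
  qed
  have lim: "(\<lambda>n. u n z) \<longlonglongrightarrow> (cmod (?X z))\<^sup>2" for z
  proof -
    have "e \<longlonglongrightarrow> 0" unfolding e_def by (rule LIMSEQ_inverse_real_of_nat)
    then have "(\<lambda>n. u n z) \<longlonglongrightarrow> 1 * (cmod (?X z))\<^sup>2"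
      unfolding u_def by (intro tendsto_mult tendsto_const gauss_scaleR_tendsto_1)
    then show ?thesis by simp
  qed
  have "(\<integral>\<^sup>+z. ennreal ((cmod (?X z))\<^sup>2) \<partial>lborel) = (\<integral>\<^sup>+z. liminf (\<lambda>n. ennreal (u n z)) \<partial>lborel)"
    by (intro nn_integral_cong lim_imp_Liminf[symmetric]) (auto intro!: lim)
  also have "\<dots> \<le> liminf (\<lambda>n. \<integral>\<^sup>+z. ennreal (u n z) \<partial>lborel)"
    by (rule nn_integral_liminf) measurable
  also have "\<dots> \<le> ennreal K"
    using u_bound by (intro Liminf_le) auto
  finally have "(\<integral>\<^sup>+z. ennreal ((cmod (?X z))\<^sup>2) \<partial>lborel) < \<infinity>"
    using ennreal_less_top order_le_less_trans by fastforce
  then have "integrable lborel (\<lambda>z. (cmod (?X z))\<^sup>2)"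
    by (intro integrableI_bounded) simp_all
  then show ?thesis
    unfolding square_integrable_def using cross_wigner_borel_measurable[OF f g] by blast
qed

text \<open>The regularised identity in the limit \<open>e n\<close> to 0. On the left, square
  integrability of the Wigner functions provides a majorant; on the right, the bounded continuous
  convolutions tend to their values at 0, and the two Gaussian constants multiply to the power of
  \<open>pi\<close>.\<close>

theorem moyal_identity:
  fixes f1 f2 f3 f4 :: "'a::euclidean_space \<Rightarrow> complex"
  assumes f1: "square_integrable f1" and f2: "square_integrable f2"
    and f3: "square_integrable f3" and f4: "square_integrable f4"
  shows "integrable lborel (\<lambda>z. cross_wigner f1 f2 z * cross_wigner f3 f4 (- z))"
    and "(\<integral>z. cross_wigner f1 f2 z * cross_wigner f3 f4 (- z) \<partial>lborel)
      = of_real (pi ^ DIM('a)) * (conv f1 f4 0 * conv f2 f3 0)"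
proof -
  let ?H = "\<lambda>z. cross_wigner f1 f2 z * cross_wigner f3 f4 (- z)"
  from integrable_mult_square_integrable[OF cross_wigner_square_integrable[OF f1 f2]
      square_integrable_reflect[OF cross_wigner_square_integrable[OF f3 f4], of 0]]
  show H: "integrable lborel ?H" by simp
  have [measurable]: "?H \<in> borel_measurable borel" using borel_measurable_integrable[OF H] by simp
  define e :: "nat \<Rightarrow> real" where "e n = inverse (real (Suc n))" for n
  have e: "e n > 0" for n by (simp add: e_def)
  have e0: "e \<longlonglongrightarrow> 0" unfolding e_def by (rule LIMSEQ_inverse_real_of_nat)
  let ?h = "\<lambda>n z. of_real (gauss (e n *\<^sub>R snd z)) * ?H z"
  let ?k = "\<lambda>n w. conv f1 f4 (e n *\<^sub>R w) * conv f2 f3 (- (e n *\<^sub>R w))"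
  have c14: "continuous_on UNIV (conv f1 f4)" and c23: "continuous_on UNIV (conv f2 f3)"
    by (intro continuous_on_compose2[OF mod_conv_continuous] f1 f2 f3 f4 continuous_intros, simp)+
  have [measurable]: "(\<lambda>z::'a \<times> 'a. complex_of_real (gauss (e n *\<^sub>R snd z))) \<in> borel_measurable borel" for n
    by (intro borel_measurable_continuous_onI continuous_intros)
  have hb: "cmod (?h n z) \<le> cmod (?H z)" for n z
    unfolding norm_mult[of "of_real _"] by (rule mult_left_le_one_le) auto
  have L: "(\<lambda>n. \<integral>z. ?h n z \<partial>lborel) \<longlonglongrightarrow> (\<integral>z. ?H z \<partial>lborel)"
  proof (rule integral_dominated_convergence[OF _ _ integrable_norm[OF H]])
    show "AE z in lborel. (\<lambda>n. ?h n z) \<longlonglongrightarrow> ?H z"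
    proof (rule AE_I2)
      fix z :: "'a \<times> 'a"
      have "(\<lambda>n. ?h n z) \<longlonglongrightarrow> of_real 1 * ?H z"
        by (intro tendsto_mult tendsto_const tendsto_of_real gauss_scaleR_tendsto_1 e0)
      then show "(\<lambda>n. ?h n z) \<longlonglongrightarrow> ?H z" by simp
    qed
    show "?h n \<in> borel_measurable lborel" for n
      by (intro borel_measurable_times[of "\<lambda>z. of_real (gauss (e n *\<^sub>R snd z))"]) simp_all
  qed (use hb in auto)
  have eq: "(\<integral>z. ?h n z \<partial>lborel)
    = of_real ((sqrt (2 * pi) / 2) ^ DIM('a)) * (\<integral>w. of_real (gauss w) * ?k n w \<partial>lborel)" for n
  proof -
    have "integrable (lborel \<Otimes>\<^sub>M lborel) (?h n)"
      unfolding lborel_prod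
      by (rule Bochner_Integration.integrable_bound[OF H])
         (use hb in \<open>auto intro: borel_measurable_times[of "\<lambda>z. of_real (gauss (e n *\<^sub>R snd z))"]\<close>)
    from lborel_pair.integral_fst'[OF this] moyal_regularized(2)[OF f1 f2 f3 f4 e[of n]]
    show ?thesis by (simp add: lborel_prod)
  qed
  obtain B1 where B1: "B1 \<ge> 0" "\<And>z. cmod (mod_conv f1 f4 z) \<le> B1"
    using norm_mod_conv_bound[OF f1 f4] by metis
  obtain B2 where B2: "B2 \<ge> 0" "\<And>z. cmod (mod_conv f2 f3 z) \<le> B2"
    using norm_mod_conv_bound[OF f2 f3] by metis
  have "(\<lambda>n. \<integral>w. of_real (gauss w) * ?k n w \<partial>lborel)
    \<longlonglongrightarrow> (\<integral>w. of_real (gauss (w::'a)) * (conv f1 f4 0 * conv f2 f3 0) \<partial>lborel)"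
  proof (rule integral_dominated_convergence)
    show "integrable lborel (\<lambda>w::'a. gauss w * (B1 * B2))"
      by (intro integrable_mult_left integrable_gauss)
    show "AE w in lborel. (\<lambda>n. of_real (gauss w) * ?k n w) \<longlonglongrightarrow> of_real (gauss w) * (conv f1 f4 0 * conv f2 f3 0)"
    proof (rule AE_I2)
      fix w :: 'a
      have z: "(\<lambda>n. e n *\<^sub>R w) \<longlonglongrightarrow> 0"
        using tendsto_scaleR[OF e0 tendsto_const[of w]] by simp
      have "(\<lambda>n. conv f1 f4 (e n *\<^sub>R w)) \<longlonglongrightarrow> conv f1 f4 0"
        by (rule continuous_on_tendsto_compose[OF c14 z]) auto
      moreover have "(\<lambda>n. conv f2 f3 (- (e n *\<^sub>R w))) \<longlonglongrightarrow> conv f2 f3 0"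
        by (rule continuous_on_tendsto_compose[OF c23]) (use tendsto_minus[OF z] in auto)
      ultimately show "(\<lambda>n. of_real (gauss w) * ?k n w) \<longlonglongrightarrow> of_real (gauss w) * (conv f1 f4 0 * conv f2 f3 0)"
        by (intro tendsto_mult tendsto_const)
    qed
    have "(\<lambda>w. of_real (gauss w) * ?k n w) \<in> borel_measurable borel" for n
      by (intro borel_measurable_continuous_onI continuous_intros
          continuous_on_compose2[OF c14] continuous_on_compose2[OF c23]) auto
    then show "(\<lambda>w. of_real (gauss w) * ?k n w) \<in> borel_measurable lborel" for n
      by simp
    show "AE w in lborel. cmod (of_real (gauss w) * ?k n w) \<le> gauss w * (B1 * B2)" for n
      using B1 B2 by (intro AE_I2) (auto simp: norm_mult intro!: mult_left_mono mult_mono)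
  qed simp
  also have "(\<integral>w. of_real (gauss (w::'a)) * (conv f1 f4 0 * conv f2 f3 0) \<partial>lborel)
    = of_real (sqrt (2 * pi) ^ DIM('a)) * (conv f1 f4 0 * conv f2 f3 0)"
    by (simp add: integral_gauss)
  finally have "(\<lambda>n. \<integral>z. ?h n z \<partial>lborel) \<longlonglongrightarrow>
    of_real ((sqrt (2 * pi) / 2) ^ DIM('a)) * (of_real (sqrt (2 * pi) ^ DIM('a)) * (conv f1 f4 0 * conv f2 f3 0))"
    unfolding eq by (intro tendsto_intros)
  from LIMSEQ_unique[OF L this]
  have "(\<integral>z. ?H z \<partial>lborel) = of_real ((sqrt (2 * pi) / 2) ^ DIM('a) * sqrt (2 * pi) ^ DIM('a)) * (conv f1 f4 0 * conv f2 f3 0)"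
    by simp
  also have "(sqrt (2 * pi) / 2) ^ DIM('a) * sqrt (2 * pi) ^ DIM('a) = pi ^ DIM('a)"
    by (simp flip: power_mult_distrib)
  finally show "(\<integral>z. ?H z \<partial>lborel) = of_real (pi ^ DIM('a)) * (conv f1 f4 0 * conv f2 f3 0)" .
qed

section \<open>The negative set of the Wigner function\<close>

text \<open>The function \<open>A\<close> of the overview. Taking the real part loses nothing, by
  the next lemma.\<close>

definition auto_wigner :: "('a::euclidean_space \<Rightarrow> complex) \<Rightarrow> 'a \<times> 'a \<Rightarrow> real" where
  "auto_wigner f z = Re (cross_wigner f (\<lambda>x. cnj (f x)) z)"

text \<open>Conjugating the integrand has the same effect as replacing \<open>t\<close> by
  \<open>- t\<close>, so the integral is real.\<close>

lemma cross_wigner_cnj_eq: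
  "cross_wigner f (\<lambda>x. cnj (f x)) z = complex_of_real (auto_wigner f z)"
proof -
  obtain y q where z: "z = (y, q)" by force
  have "cnj (cross_wigner f (\<lambda>x. cnj (f x)) z)
    = (LINT t|lborel. cnj (f (y + t) * cnj (f (y - t)) * cis (- (q \<bullet> t))))"
    unfolding z cross_wigner_def prod.case by (rule Bochner_Integration.integral_cnj[symmetric])
  also have "\<dots> = (LINT t|lborel. cnj (f (y + (0 - t)) * cnj (f (y - (0 - t))) * cis (- (q \<bullet> (0 - t)))))"
    by (rule integral_lborel_reflect[symmetric])
  also have "\<dots> = cross_wigner f (\<lambda>x. cnj (f x)) z"
    unfolding z cross_wigner_def prod.case
    by (intro Bochner_Integration.integral_cong refl) (simp add: cis_cnj)
  finally show ?thesis
    by (simp add: auto_wigner_def complex_eq_iff)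
qed

lemma auto_wigner_continuous:
  "square_integrable f \<Longrightarrow> continuous_on UNIV (auto_wigner f)"
  unfolding auto_wigner_def[abs_def]
  by (intro continuous_intros cross_wigner_continuous square_integrable_cnj) auto

text \<open>Covariance under phase-space translations. The modulation carries half the frequency
  because the arguments \<open>y + t\<close> and \<open>y - t\<close> differ by
  \<open>2 t\<close>.\<close>

lemma auto_wigner_translate:
  "auto_wigner (\<lambda>u. f (x + u) * cis (- (p \<bullet> u) / 2)) z = auto_wigner f ((x, p) + z)"
proof -
  obtain y q where z: "z = (y, q)" by force
  have "cross_wigner (\<lambda>u. f (x + u) * cis (- (p \<bullet> u) / 2)) (\<lambda>u. cnj (f (x + u) * cis (- (p \<bullet> u) / 2))) z
    = cross_wigner f (\<lambda>x. cnj (f x)) ((x, p) + z)"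
    unfolding z add_Pair cross_wigner_def prod.case
  proof (intro Bochner_Integration.integral_cong refl)
    fix t
    have "cis (- (p \<bullet> (y + t)) / 2) * cis ((p \<bullet> (y - t)) / 2) * cis (- (q \<bullet> t)) = cis (- ((p + q) \<bullet> t))"
      unfolding cis_mult by (rule arg_cong[where f=cis]) (simp add: inner_simps field_simps)
    moreover have "cnj (cis (- (p \<bullet> (y - t)) / 2)) = cis ((p \<bullet> (y - t)) / 2)"
      by (simp add: cis_cnj)
    moreover have "x + (y + t) = x + y + t" "x + (y - t) = x + y - t" by simp_all
    moreover have "f (x + (y + t)) * cis (- (p \<bullet> (y + t)) / 2) * cnj (f (x + (y - t)) * cis (- (p \<bullet> (y - t)) / 2)) * cis (- (q \<bullet> t))
      = f (x + (y + t)) * cnj (f (x + (y - t))) *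
        (cis (- (p \<bullet> (y + t)) / 2) * cnj (cis (- (p \<bullet> (y - t)) / 2)) * cis (- (q \<bullet> t)))"
      by (simp only: complex_cnj_mult mult_ac)
    ultimately show "f (x + (y + t)) * cis (- (p \<bullet> (y + t)) / 2) * cnj (f (x + (y - t)) * cis (- (p \<bullet> (y - t)) / 2)) * cis (- (q \<bullet> t)) =
         f (x + y + t) * cnj (f (x + y - t)) * cis (- ((p + q) \<bullet> t))"
      by (simp only:)
  qed
  then show ?thesis by (simp add: auto_wigner_def)
qed

section \<open>The Wigner function of a Gaussian and the existence of positive values\<close>

lemma square_integrable_gauss: "square_integrable (\<lambda>x. complex_of_real (gauss x))"
  by (rule square_integrable_bound[OF integrable_gauss])
     (auto simp: power2_eq_square intro!: mult_left_le)

text \<open>The parallelogram law separates \<open>y\<close> from \<open>t\<close> and leaves the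
  Fourier transform of a Gaussian; the outcome is strictly positive.\<close>

lemma cross_wigner_gauss:
  fixes y q :: "'a::euclidean_space"
  shows "cross_wigner (\<lambda>x. of_real (gauss x)) (\<lambda>x. of_real (gauss x)) (y, q)
    = of_real (gauss (sqrt 2 *\<^sub>R y) * ((sqrt (2 * pi) / sqrt 2) ^ DIM('a) * gauss ((1 / sqrt 2) *\<^sub>R q)))"
proof -
  have par: "gauss (y + t) * gauss (y - t) = gauss (sqrt 2 *\<^sub>R y) * gauss (sqrt 2 *\<^sub>R t)" for t :: 'a
  proof -
    have "(norm (y + t))\<^sup>2 + (norm (y - t))\<^sup>2 = 2 * (norm y)\<^sup>2 + 2 * (norm t)\<^sup>2"
      by (simp add: power2_norm_eq_inner inner_simps inner_commute)
    then show ?thesis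
      unfolding gauss_def exp_add[symmetric] by (simp add: power_mult_distrib)
  qed
  have "cross_wigner (\<lambda>x. of_real (gauss x)) (\<lambda>x. of_real (gauss x)) (y, q)
    = (\<integral>t. of_real (gauss (sqrt 2 *\<^sub>R y)) * (of_real (gauss (sqrt 2 *\<^sub>R t)) * cis (- (t \<bullet> q))) \<partial>lborel)"
    unfolding cross_wigner_def prod.case of_real_mult[symmetric] par
    by (simp add: inner_commute mult_ac)
  also have "\<dots> = of_real (gauss (sqrt 2 *\<^sub>R y)) * (\<integral>t. of_real (gauss (sqrt 2 *\<^sub>R t)) * cis (- (t \<bullet> q)) \<partial>lborel)"
    by (rule integral_mult_right_zero)
  finally show ?thesis
    by (simp add: gauss_fourier_scaled)
qed

lemma AE_zero_continuous:
  fixes h :: "'b::euclidean_space \<Rightarrow> real"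
  assumes "continuous_on UNIV h" "AE x in lborel. h x = 0"
  shows "h x = 0"
proof (rule ccontr)
  assume "h x \<noteq> 0"
  moreover have op: "open {x. h x \<noteq> 0}"
    using open_Collect_neq[OF assms(1), of "\<lambda>_. 0"] by simp
  moreover have "negligible {x. h x \<noteq> 0}"
    using assms(2) op by (auto simp: negligible_iff_null_sets null_sets_completionI AE_iff_null)
  ultimately show False using open_not_negligible by blast
qed

lemma auto_wigner_pos_exists:
  fixes f :: "'a::euclidean_space \<Rightarrow> complex"
  assumes f: "square_integrable f" and z0: "auto_wigner f z0 \<noteq> 0"
  shows "\<exists>z. auto_wigner f z > 0"
proof (rule ccontr)
  assume "\<not> ?thesis"
  then have neg: "auto_wigner f z \<le> 0" for z by (meson not_le)
  let ?g = "\<lambda>x::'a. complex_of_real (gauss x)"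
  define h where "h z = gauss (sqrt 2 *\<^sub>R fst z) * ((sqrt (2 * pi) / sqrt 2) ^ DIM('a) * gauss ((1 / sqrt 2) *\<^sub>R snd z))"
    for z :: "'a \<times> 'a"
  have h: "cross_wigner ?g ?g (- z) = of_real (h z)" for z
    using cross_wigner_gauss[of "- fst z" "- snd z"] by (cases z) (simp add: h_def gauss_def)
  have h_pos: "h z > 0" for z by (simp add: h_def)
  have h_cont: "continuous_on UNIV h" unfolding h_def[abs_def] by (intro continuous_intros)
  note f' = square_integrable_cnj[OF f]
  note M = moyal_identity[OF f f' square_integrable_gauss square_integrable_gauss, unfolded cross_wigner_cnj_eq h of_real_mult[symmetric]]
  have int: "integrable lborel (\<lambda>z. auto_wigner f z * h z)"
    using M(1) by (simp only: complex_of_real_integrable_eq)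
  \<comment> \<open>The Gaussian is real, so the two convolutions in Moyal's identity are conjugate
    to each other and their product is a squared modulus.\<close>
  have "conv (\<lambda>x. cnj (f x)) ?g 0 = cnj (conv f ?g 0)"
    unfolding conv_eq by (simp flip: Bochner_Integration.integral_cnj)
  then have "complex_of_real (\<integral>z. auto_wigner f z * h z \<partial>lborel)
    = of_real (pi ^ DIM('a) * (cmod (conv f ?g 0))\<^sup>2)"
    using M(2) unfolding integral_complex_of_real by (simp only: complex_norm_square of_real_mult)
  then have "(\<integral>z. auto_wigner f z * h z \<partial>lborel) \<ge> 0"
    unfolding of_real_eq_iff by simp
  moreover have nn: "0 \<le> - (auto_wigner f z * h z)" for z
    using mult_nonpos_nonneg[OF neg less_imp_le[OF h_pos]] by simp
  moreover have "0 \<le> (\<integral>z. - (auto_wigner f z * h z) \<partial>lborel)"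
    by (intro Bochner_Integration.integral_nonneg nn)
  \<comment> \<open>A nonpositive integrand with nonnegative integral vanishes almost everywhere,
    hence everywhere by continuity, against the choice of \<open>z0\<close>.\<close>
  ultimately have "(\<integral>z. - (auto_wigner f z * h z) \<partial>lborel) = 0" by simp
  then have "AE z in lborel. - (auto_wigner f z * h z) = 0"
    using integral_nonneg_eq_0_iff_AE[OF integrable_minus[OF int]] nn by simp
  moreover have "continuous_on UNIV (\<lambda>z. - (auto_wigner f z * h z))"
    by (intro continuous_intros auto_wigner_continuous f h_cont)
  ultimately have "- (auto_wigner f z0 * h z0) = 0" by (rule AE_zero_continuous[rotated])
  with z0 h_pos[of z0] show False by simp
qed

text \<open>The sup bound behind the self-duality of \<open>G\<close>: Moyal's identity is applied
  to modulated translates \<open>?f1\<close>, \<open>?f2\<close> whose cross Wigner function has the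
  modulus of \<open>A\<close>, while their pairings at 0 with \<open>f\<close> and its conjugate
  yield \<open>A z\<close> and \<open>A (- z)\<close> up to phases.\<close>

lemma auto_wigner_product_sup:
  fixes f :: "'a::euclidean_space \<Rightarrow> complex"
  assumes f: "square_integrable f"
  shows "pi ^ DIM('a) * \<bar>auto_wigner f z * auto_wigner f (- z)\<bar>
    \<le> (\<integral>w. \<bar>auto_wigner f w * auto_wigner f (- w)\<bar> \<partial>lborel)"
proof -
  obtain s r where z: "z = (s, r)" by force
  let ?c = "\<lambda>x. cis (- (r \<bullet> x))"
  let ?f1 = "\<lambda>x. f (2 *\<^sub>R s + x) * ?c x" and ?f2 = "\<lambda>x. cnj (f (- 2 *\<^sub>R s + x)) * ?c x"
  let ?f' = "\<lambda>x. cnj (f x)"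
  note f' = square_integrable_cnj[OF f]
  have f1: "square_integrable ?f1" and f2: "square_integrable ?f2"
    by (intro square_integrable_unimodular square_integrable_translate[OF f] square_integrable_translate[OF f'], simp, simp)+
  \<comment> \<open>Translating \<open>t\<close> by \<open>- 2 s\<close> undoes the opposite shifts
    in \<open>?f1\<close> and \<open>?f2\<close>; what remains is a phase independent of
    \<open>t\<close>.\<close>
  have X: "cmod (cross_wigner ?f1 ?f2 w) = \<bar>auto_wigner f w\<bar>" for w
  proof -
    obtain y q where w: "w = (y, q)" by force
    have "cross_wigner ?f1 ?f2 w = (\<integral>t. ?f1 (y + (- 2 *\<^sub>R s + t)) * ?f2 (y - (- 2 *\<^sub>R s + t)) * cis (- (q \<bullet> (- 2 *\<^sub>R s + t))) \<partial>lborel)"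
      unfolding w cross_wigner_def prod.case by (rule integral_lborel_translate[symmetric])
    also have "\<dots> = (\<integral>t. cis (- 2 * (r \<bullet> y) + 2 * (q \<bullet> s)) * (f (y + t) * cnj (f (y - t)) * cis (- (q \<bullet> t))) \<partial>lborel)"
    proof (intro Bochner_Integration.integral_cong refl)
      fix t
      have "cis (- (r \<bullet> (y + (- 2 *\<^sub>R s + t)))) * cis (- (r \<bullet> (y - (- 2 *\<^sub>R s + t)))) * cis (- (q \<bullet> (- 2 *\<^sub>R s + t)))
        = cis (- 2 * (r \<bullet> y) + 2 * (q \<bullet> s)) * cis (- (q \<bullet> t))"
        unfolding cis_mult by (rule arg_cong[where f=cis]) (simp add: inner_simps)
      moreover have "2 *\<^sub>R s + (y + (- 2 *\<^sub>R s + t)) = y + t" "- 2 *\<^sub>R s + (y - (- 2 *\<^sub>R s + t)) = y - t"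
        by (simp_all add: algebra_simps)
      moreover have "?f1 (y + (- 2 *\<^sub>R s + t)) * ?f2 (y - (- 2 *\<^sub>R s + t)) * cis (- (q \<bullet> (- 2 *\<^sub>R s + t)))
        = f (2 *\<^sub>R s + (y + (- 2 *\<^sub>R s + t))) * cnj (f (- 2 *\<^sub>R s + (y - (- 2 *\<^sub>R s + t)))) *
          (cis (- (r \<bullet> (y + (- 2 *\<^sub>R s + t)))) * cis (- (r \<bullet> (y - (- 2 *\<^sub>R s + t)))) * cis (- (q \<bullet> (- 2 *\<^sub>R s + t))))"
        by (simp only: mult_ac)
      ultimately show "?f1 (y + (- 2 *\<^sub>R s + t)) * ?f2 (y - (- 2 *\<^sub>R s + t)) * cis (- (q \<bullet> (- 2 *\<^sub>R s + t)))
        = cis (- 2 * (r \<bullet> y) + 2 * (q \<bullet> s)) * (f (y + t) * cnj (f (y - t)) * cis (- (q \<bullet> t)))"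
        by (simp only: mult.left_commute)
    qed
    also have "\<dots> = cis (- 2 * (r \<bullet> y) + 2 * (q \<bullet> s)) * cross_wigner f ?f' w"
      unfolding w cross_wigner_def prod.case by (rule integral_mult_right_zero)
    finally show ?thesis by (simp add: norm_mult cross_wigner_cnj_eq)
  qed
  \<comment> \<open>Translating the variable by \<open>- s\<close> here, and reflecting it about
    \<open>s\<close> in \<open>c2\<close>, turns the pairings into Wigner integrals at
    \<open>(s, r)\<close> and \<open>(- s, - r)\<close>.\<close>
  have c1: "conv ?f1 ?f' 0 = cis (r \<bullet> s) * cross_wigner f ?f' (s, r)"
  proof -
    have "conv ?f1 ?f' 0 = (\<integral>t. ?f1 (- s + t) * ?f' (0 - (- s + t)) \<partial>lborel)"
      unfolding conv_eq by (rule integral_lborel_translate[symmetric])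
    also have "\<dots> = (\<integral>t. cis (r \<bullet> s) * (f (s + t) * cnj (f (s - t)) * cis (- (r \<bullet> t))) \<partial>lborel)"
    proof (intro Bochner_Integration.integral_cong refl)
      fix t
      have "cis (- (r \<bullet> (- s + t))) = cis (r \<bullet> s) * cis (- (r \<bullet> t))"
        unfolding cis_mult by (simp add: inner_simps)
      moreover have "2 *\<^sub>R s + (- s + t) = s + t" "0 - (- s + t) = s - t" by (simp_all add: scaleR_2)
      ultimately show "?f1 (- s + t) * ?f' (0 - (- s + t)) = cis (r \<bullet> s) * (f (s + t) * cnj (f (s - t)) * cis (- (r \<bullet> t)))"
        by (simp only: mult_ac)
    qed
    also have "\<dots> = cis (r \<bullet> s) * cross_wigner f ?f' (s, r)"
      unfolding cross_wigner_def prod.case by (rule integral_mult_right_zero)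
    finally show ?thesis .
  qed
  have c2: "conv ?f2 f 0 = cis (- (r \<bullet> s)) * cross_wigner f ?f' (- s, - r)"
  proof -
    have "conv ?f2 f 0 = (\<integral>t. ?f2 (s - t) * f (0 - (s - t)) \<partial>lborel)"
      unfolding conv_eq by (rule integral_lborel_reflect[symmetric])
    also have "\<dots> = (\<integral>t. cis (- (r \<bullet> s)) * (f (- s + t) * cnj (f (- s - t)) * cis (- (- r \<bullet> t))) \<partial>lborel)"
    proof (intro Bochner_Integration.integral_cong refl)
      fix t
      have "cis (- (r \<bullet> (s - t))) = cis (- (r \<bullet> s)) * cis (- (- r \<bullet> t))"
        unfolding cis_mult by (simp add: inner_simps)
      moreover have "- 2 *\<^sub>R s + (s - t) = - s - t" "0 - (s - t) = - s + t"
        by (simp_all add: scaleR_2)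
      ultimately show "?f2 (s - t) * f (0 - (s - t)) = cis (- (r \<bullet> s)) * (f (- s + t) * cnj (f (- s - t)) * cis (- (- r \<bullet> t)))"
        by (simp only: mult_ac)
    qed
    also have "\<dots> = cis (- (r \<bullet> s)) * cross_wigner f ?f' (- s, - r)"
      unfolding cross_wigner_def prod.case by (rule integral_mult_right_zero)
    finally show ?thesis .
  qed
  have "pi ^ DIM('a) * \<bar>auto_wigner f z * auto_wigner f (- z)\<bar>
    = cmod (of_real (pi ^ DIM('a)) * (conv ?f1 ?f' 0 * conv ?f2 f 0))"
    unfolding c1 c2 by (simp add: z norm_mult norm_power cross_wigner_cnj_eq abs_mult)
  also have "\<dots> = cmod (\<integral>w. cross_wigner ?f1 ?f2 w * cross_wigner f ?f' (- w) \<partial>lborel)"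
    by (simp only: moyal_identity(2)[OF f1 f2 f f'])
  also have "\<dots> \<le> (\<integral>w. cmod (cross_wigner ?f1 ?f2 w * cross_wigner f ?f' (- w)) \<partial>lborel)"
    by (rule integral_norm_bound)
  also have "\<dots> = (\<integral>w. \<bar>auto_wigner f w * auto_wigner f (- w)\<bar> \<partial>lborel)"
    by (simp only: norm_mult X cross_wigner_cnj_eq norm_of_real abs_mult)
  finally show ?thesis .
qed

section \<open>A lower bound on the measure of the negative set\<close>

lemma emeasure_lborel_uminus:
  fixes S :: "'b::euclidean_space set"
  assumes [measurable]: "S \<in> sets borel"
  shows "emeasure lborel {z. - z \<in> S} = emeasure lborel S"
proof -
  have "emeasure lborel S = (\<integral>\<^sup>+z. indicator S z \<partial>lborel)" by simp
  also have "\<dots> = (\<integral>\<^sup>+z. indicator S (0 + (-1) *\<^sub>R z) \<partial>lborel)"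
    by (subst nn_integral_lborel_affine[where c="-1" and t=0]) auto
  also have "\<dots> = (\<integral>\<^sup>+z. indicator {z. - z \<in> S} z \<partial>lborel)"
    by (intro nn_integral_cong) (auto simp: indicator_def)
  also have "\<dots> = emeasure lborel {z. - z \<in> S}" by simp
  finally show ?thesis by simp
qed

text \<open>Since \<open>G\<close> has mean zero, its negative part carries half of its L1 norm; the
  sup bound then keeps the set carrying that part from being small. The point \<open>w0\<close>
  serves to make the L1 norm positive, so that it can be cancelled.\<close>

lemma auto_wigner_neg_measure_if_zero_at_0:
  fixes f :: "'a::euclidean_space \<Rightarrow> complex"
  assumes f: "square_integrable f" and zero: "auto_wigner f 0 = 0"
    and nz: "auto_wigner f w0 * auto_wigner f (- w0) \<noteq> 0"
  shows "ennreal (pi ^ DIM('a) / 4) \<le> emeasure lborel {z. auto_wigner f z < 0}"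
proof (cases "emeasure lborel {z. auto_wigner f z < 0} = \<infinity>")
  case fin: False
  let ?N = "{z. auto_wigner f z < 0}"
  define G where "G z = auto_wigner f z * auto_wigner f (- z)" for z
  define I where "I = (\<integral>z. \<bar>G z\<bar> \<partial>lborel)"
  \<comment> \<open>A product is negative only if one of its factors is, so \<open>G\<close> is
    nonnegative outside \<open>?N\<close> and its reflection.\<close>
  define D where "D = ?N \<union> {z. - z \<in> ?N}"
  note f' = square_integrable_cnj[OF f]
  note c = auto_wigner_continuous[OF f]
  have "open ?N" using open_Collect_less[OF c, of "\<lambda>_. 0"] by simp
  then have N[measurable]: "?N \<in> sets borel" by simp
  have N': "{z. - z \<in> ?N} \<in> sets borel"
    using open_Collect_less[of "\<lambda>z. auto_wigner f (- z)" "\<lambda>_. 0"]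
      continuous_on_compose2[OF c continuous_on_minus[OF continuous_on_id]] by simp
  have D: "D \<in> sets borel" unfolding D_def using N N' by blast
  have eD: "emeasure lborel D \<le> 2 * emeasure lborel ?N"
    using emeasure_subadditive[of ?N lborel "{z. - z \<in> ?N}"] N N' emeasure_lborel_uminus[OF N]
    by (simp add: D_def mult_2)
  then have D_fin: "emeasure lborel D < \<infinity>"
    using fin by (auto simp: ennreal_mult_less_top less_top intro: order_le_less_trans)
  note M = moyal_identity[OF f f' f f', unfolded cross_wigner_cnj_eq of_real_mult[symmetric]]
  have G: "integrable lborel G"
    using M(1) unfolding complex_of_real_integrable_eq G_def[abs_def] .
  \<comment> \<open>At the origin the Wigner integral is this very convolution, so
    \<open>zero\<close> annihilates the right side of Moyal's identity.\<close>
  have "conv f (\<lambda>x. cnj (f x)) 0 = cross_wigner f (\<lambda>x. cnj (f x)) 0"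
    by (simp add: conv_eq cross_wigner_def zero_prod_def)
  then have "complex_of_real (\<integral>z. G z \<partial>lborel) = 0"
    using M(2) zero unfolding integral_complex_of_real G_def by (simp add: cross_wigner_cnj_eq)
  then have G0: "(\<integral>z. G z \<partial>lborel) = 0" by simp
  have sup: "pi ^ DIM('a) * \<bar>G z\<bar> \<le> I" for z
    unfolding G_def I_def by (rule auto_wigner_product_sup[OF f])
  have "0 < pi ^ DIM('a) * \<bar>G w0\<bar>" using nz by (simp add: G_def)
  with sup[of w0] have I: "I > 0" by linarith
  have "I = (\<integral>z. \<bar>G z\<bar> - G z \<partial>lborel)"
    using G G0 by (simp add: I_def)
  also have "\<dots> \<le> (\<integral>z. 2 * (I / pi ^ DIM('a)) * indicator D z \<partial>lborel)"
  proof (rule integral_mono)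
    show "integrable lborel (\<lambda>z. \<bar>G z\<bar> - G z)" using G by simp
    show "integrable lborel (\<lambda>z. 2 * (I / pi ^ DIM('a)) * indicator D z)"
      by (intro integrable_mult_right integrable_real_indicator) (use D D_fin in auto)
    fix z
    show "\<bar>G z\<bar> - G z \<le> 2 * (I / pi ^ DIM('a)) * indicator D z"
    proof (cases "z \<in> D")
      case True
      have "\<bar>G z\<bar> - G z \<le> 2 * \<bar>G z\<bar>" by simp
      also have "\<bar>G z\<bar> \<le> I / pi ^ DIM('a)" using sup[of z] by (simp add: field_simps)
      finally show ?thesis using True by simp
    next
      case False
      then have "G z \<ge> 0" by (simp add: D_def G_def not_less)
      with False show ?thesis by simp
    qed
  qed
  also have "\<dots> = 2 * (I / pi ^ DIM('a)) * measure lborel D"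
    by simp
  finally have "I * pi ^ DIM('a) \<le> I * (2 * measure lborel D)"
    by (simp add: field_simps)
  then have "pi ^ DIM('a) / 4 \<le> measure lborel D / 2"
    using I by simp
  also have "measure lborel D \<le> 2 * measure lborel ?N"
  proof -
    have "ennreal (measure lborel D) \<le> ennreal (2 * measure lborel ?N)"
      using eD D_fin fin by (simp add: emeasure_eq_ennreal_measure ennreal_mult)
    then show ?thesis by (simp add: ennreal_le_iff)
  qed
  finally have "pi ^ DIM('a) / 4 \<le> measure lborel ?N" by simp
  then show ?thesis
    using fin by (simp add: emeasure_eq_ennreal_measure ennreal_leI)
qed simp

section \<open>Zeros that are midpoints of two nonzeros\<close>

lemma dyadic_between:
  fixes x y :: real
  assumes "0 \<le> x" "x < y" "y \<le> 1"
  obtains k m :: nat where "k \<le> 2 ^ m" "x < k / 2 ^ m" "k / 2 ^ m < y"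
proof -
  obtain m :: nat where m: "1 / (y - x) < 2 ^ m"
    using real_arch_pow[of 2 "1 / (y - x)"] by auto
  define k where "k = nat \<lfloor>x * 2 ^ m\<rfloor> + 1"
  have k: "real k = of_int \<lfloor>x * 2 ^ m\<rfloor> + 1" using assms by (simp add: k_def)
  have "x * 2 ^ m < real k" "real k \<le> x * 2 ^ m + 1" unfolding k by linarith+
  moreover have "1 < (y - x) * 2 ^ m" using m assms by (simp add: field_simps)
  ultimately have *: "x * 2 ^ m < k" "k < y * 2 ^ m" by (auto simp: algebra_simps)
  moreover have "y * 2 ^ m \<le> 2 ^ m" using assms by simp
  ultimately have "real k \<le> 2 ^ m" by linarith
  then have "k \<le> 2 ^ m" by (metis of_nat_le_iff of_nat_numeral of_nat_power)
  with * that[of k m] show thesis by (simp add: field_simps)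
qed

text \<open>
  Otherwise \<open>\<phi>\<close> is nonzero at all dyadic points of the unit interval; reflecting a small interval around one of
  them in a zero of \<open>\<phi>\<close> hits another dyadic point.
\<close>

lemma zero_at_midpoint_of_nonzeros_real:
  fixes \<phi> :: "real \<Rightarrow> real"
  assumes cont: "continuous_on UNIV \<phi>" and neg: "\<phi> 0 < 0" and pos: "\<phi> 1 > 0"
  shows "\<exists>t h. \<phi> t = 0 \<and> \<phi> (t + h) * \<phi> (t - h) \<noteq> 0"
proof (rule ccontr)
  assume "\<not> ?thesis"
  then have H: "\<phi> t = 0 \<Longrightarrow> \<phi> (t + h) * \<phi> (t - h) = 0" for t h by blast
  have dy: "\<phi> (k / 2 ^ m) \<noteq> 0" if "k \<le> 2 ^ m" for k m :: nat
    using that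
  proof (induction m arbitrary: k)
    case 0
    then have "k = 0 \<or> k = 1" by auto
    with neg pos show ?case by auto
  next
    case (Suc m)
    show ?case
    proof (cases "even k")
      case True
      then obtain j where j: "k = 2 * j" by blast
      with Suc.prems have "j \<le> 2 ^ m" by simp
      with Suc.IH[of j] show ?thesis by (simp add: j)
    next
      case False
      then obtain j where j: "k = 2 * j + 1" by (metis oddE)
      with Suc.prems have "j \<le> 2 ^ m" "j + 1 \<le> 2 ^ m" by simp_all
      then have "\<phi> (j / 2 ^ m) \<noteq> 0" "\<phi> ((j + 1) / 2 ^ m) \<noteq> 0" using Suc.IH by blast+
      \<comment> \<open>An odd multiple of the finer step is the midpoint of two neighbouring
        coarser dyadics, where \<open>\<phi>\<close> is nonzero by induction; by \<open>H\<close> it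
        cannot be a zero.\<close>
      moreover have "k / 2 ^ Suc m + 1 / 2 ^ Suc m = (j + 1) / 2 ^ m" "k / 2 ^ Suc m - 1 / 2 ^ Suc m = j / 2 ^ m"
        by (simp_all add: j field_simps)
      ultimately show ?thesis using H[of "k / 2 ^ Suc m" "1 / 2 ^ Suc m"] by auto
    qed
  qed
  obtain t where t: "0 \<le> t" "t \<le> 1" "\<phi> t = 0"
    using IVT'[of \<phi> 0 0 1] neg pos cont by (auto intro: continuous_on_subset less_imp_le)
  have t01: "0 < t" "t < 1" using t neg pos by (auto simp: less_le)
  \<comment> \<open>The lower bound \<open>2 * t - 1\<close> ensures that the reflection
    \<open>2 * t - d\<close> of the chosen point stays below 1.\<close>
  obtain k m :: nat where d: "k \<le> 2 ^ m" "max 0 (2 * t - 1) < k / 2 ^ m" "k / 2 ^ m < t"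
    by (rule dyadic_between[of "max 0 (2 * t - 1)" t]) (use t01 in auto)
  define d where "d = real k / 2 ^ m"
  have "\<phi> d \<noteq> 0" unfolding d_def using dy[OF d(1)] .
  moreover have "open {x. \<phi> x \<noteq> 0}"
    using open_Collect_neq[OF cont, of "\<lambda>_. 0"] by simp
  ultimately obtain \<eta> where \<eta>: "\<eta> > 0" "\<And>x. \<bar>x - d\<bar> < \<eta> \<Longrightarrow> \<phi> x \<noteq> 0"
    unfolding open_dist dist_real_def by blast
  \<comment> \<open>A dyadic point within \<open>\<eta>\<close> to the right of the reflection
    \<open>2 * t - d\<close>; its own reflection in \<open>t\<close> lies within
    \<open>\<eta>\<close> of \<open>d\<close>, where \<open>\<phi>\<close> does not vanish.\<close>
  obtain k' m' :: nat where d': "k' \<le> 2 ^ m'" "2 * t - d < k' / 2 ^ m'" "k' / 2 ^ m' < min 1 (2 * t - d + \<eta>)"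
    by (rule dyadic_between[of "2 * t - d" "min 1 (2 * t - d + \<eta>)"]) (use d \<eta> t01 in \<open>auto simp: d_def\<close>)
  have "\<phi> (k' / 2 ^ m') \<noteq> 0" using dy[OF d'(1)] .
  moreover have "\<phi> (2 * t - k' / 2 ^ m') \<noteq> 0"
    by (rule \<eta>(2)) (use d' \<eta>(1) in auto)
  ultimately show False using H[OF t(3), of "k' / 2 ^ m' - t"] by (simp add: algebra_simps)
qed

text \<open>The real case along the line through \<open>a\<close> and \<open>b\<close>.\<close>

lemma zero_at_midpoint_of_nonzeros:
  fixes h :: "'b::real_normed_vector \<Rightarrow> real"
  assumes cont: "continuous_on UNIV h" and "h a < 0" "h b > 0"
  shows "\<exists>z w. h z = 0 \<and> h (z + w) * h (z - w) \<noteq> 0"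
proof -
  let ?\<phi> = "\<lambda>t. h (a + t *\<^sub>R (b - a))"
  have "continuous_on UNIV ?\<phi>"
    by (intro continuous_on_compose2[OF cont] continuous_intros) auto
  then obtain t s where "?\<phi> t = 0" "?\<phi> (t + s) * ?\<phi> (t - s) \<noteq> 0"
    using zero_at_midpoint_of_nonzeros_real[of ?\<phi>] assms by auto
  then show ?thesis
    by (intro exI[of _ "a + t *\<^sub>R (b - a)"] exI[of _ "s *\<^sub>R (b - a)"]) (simp add: algebra_simps)
qed

theorem auto_wigner_neg_measure:
  fixes f :: "'a::euclidean_space \<Rightarrow> complex"
  assumes f: "square_integrable f" and neg: "auto_wigner f z1 < 0"
  shows "ennreal (pi ^ DIM('a) / 4) \<le> emeasure lborel {z. auto_wigner f z < 0}"
proof -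
  obtain z2 where "auto_wigner f z2 > 0"
    using auto_wigner_pos_exists[OF f, of z1] neg by auto
  then obtain z w where z: "auto_wigner f z = 0" and w: "auto_wigner f (z + w) * auto_wigner f (z - w) \<noteq> 0"
    using zero_at_midpoint_of_nonzeros[OF auto_wigner_continuous[OF f] neg] by blast
  \<comment> \<open>The phase-space translate of \<open>f\<close> that moves the zero
    \<open>z\<close> to the origin; Lebesgue measure is unaffected by the shift.\<close>
  define g where "g u = f (fst z + u) * cis (- (snd z \<bullet> u) / 2)" for u
  have g: "square_integrable g"
    unfolding g_def[abs_def] by (intro square_integrable_unimodular square_integrable_translate f) simp_all
  have gz: "auto_wigner g v = auto_wigner f (z + v)" for v
    using auto_wigner_translate[of f "fst z" "snd z" v] by (simp add: g_def[abs_def])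
  have "open {z. auto_wigner f z < 0}"
    using open_Collect_less[OF auto_wigner_continuous[OF f], of "\<lambda>_. 0"] by simp
  then have [measurable]: "{z. auto_wigner f z < 0} \<in> sets borel" by simp
  have "ennreal (pi ^ DIM('a) / 4) \<le> emeasure lborel {v. auto_wigner g v < 0}"
    by (rule auto_wigner_neg_measure_if_zero_at_0[OF g, of w]) (use z w in \<open>simp_all add: gz\<close>)
  also have "{v. auto_wigner g v < 0} = (+) z -` {z. auto_wigner f z < 0} \<inter> space lborel"
    by (auto simp: gz)
  also have "emeasure lborel \<dots> = emeasure (distr lborel borel ((+) z)) {z. auto_wigner f z < 0}"
    by (subst emeasure_distr) auto
  also have "\<dots> = emeasure lborel {z. auto_wigner f z < 0}"
    by (simp add: lborel_distr_plus)
  finally show ?thesis .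
qed

section \<open>Passage to the Wigner function with \<open>hbar\<close> and to balls\<close>

lemma emeasure_scale_snd:
  fixes S :: "('a::euclidean_space \<times> 'b::euclidean_space) set"
  assumes S: "open S" and c: "c > 0"
  shows "emeasure lborel S = ennreal (c ^ DIM('b)) * emeasure lborel {(x, p). (x, c *\<^sub>R p) \<in> S}"
proof -
  have S'[measurable]: "S \<in> sets (borel \<Otimes>\<^sub>M borel)" unfolding borel_prod using S by (rule borel_open)
  have "open {z. (fst z, c *\<^sub>R snd z) \<in> S}"
    using open_vimage[OF S, of "\<lambda>z. (fst z, c *\<^sub>R snd z)"] by (simp add: vimage_def continuous_intros)
  then have T[measurable]: "{(x, p). (x, c *\<^sub>R p) \<in> S} \<in> sets (borel \<Otimes>\<^sub>M borel)"
    unfolding borel_prod split_beta by (rule borel_open)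
  have fubini: "emeasure lborel A = (\<integral>\<^sup>+x. (\<integral>\<^sup>+p. indicator A (x, p) \<partial>lborel) \<partial>lborel)"
    if "A \<in> sets (borel \<Otimes>\<^sub>M borel)" for A :: "('a \<times> 'b) set"
    using lborel.emeasure_pair_measure[of A "lborel :: 'a measure"] that
    unfolding lborel_prod borel_prod by simp
  have "emeasure lborel S = (\<integral>\<^sup>+x. (\<integral>\<^sup>+p. indicator S (x, p) \<partial>lborel) \<partial>lborel)"
    by (rule fubini[OF S'])
  also have "\<dots> = (\<integral>\<^sup>+x. ennreal (c ^ DIM('b)) * (\<integral>\<^sup>+p. indicator {(x, p). (x, c *\<^sub>R p) \<in> S} (x, p) \<partial>lborel) \<partial>lborel)"
  proof (intro nn_integral_cong)
    fix x :: 'a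
    have "(\<lambda>p. indicator S (x, p) :: ennreal) \<in> borel_measurable borel" by measurable
    from nn_integral_lborel_affine[OF this, of c 0]
    show "(\<integral>\<^sup>+p. indicator S (x, p) \<partial>lborel) = ennreal (c ^ DIM('b)) * (\<integral>\<^sup>+p. indicator {(x, p). (x, c *\<^sub>R p) \<in> S} (x, p) \<partial>lborel)"
      using c by (simp add: indicator_def)
  qed
  also have "\<dots> = ennreal (c ^ DIM('b)) * (\<integral>\<^sup>+x. (\<integral>\<^sup>+p. indicator {(x, p). (x, c *\<^sub>R p) \<in> S} (x, p) \<partial>lborel) \<partial>lborel)"
    by (rule nn_integral_cmult) measurable
  also have "(\<integral>\<^sup>+x. (\<integral>\<^sup>+p. indicator {(x, p). (x, c *\<^sub>R p) \<in> S} (x, p) \<partial>lborel) \<partial>lborel)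
    = emeasure lborel {(x, p). (x, c *\<^sub>R p) \<in> S}"
    by (rule fubini[OF T, symmetric])
  finally show ?thesis .
qed

text \<open>The substitution \<open>\<tau> = 2 t\<close> contributes a power of 2 that reduces
  \<open>2 * pi * hbar\<close> to \<open>pi * hbar\<close>, and turns \<open>p / hbar\<close> into
  the frequency \<open>2 p / hbar\<close>.\<close>

lemma Re_wigner_eq:
  fixes f :: "real^'n \<Rightarrow> complex"
  assumes "hbar > 0"
  shows "Re (wigner hbar f (x, p)) = (1 / (pi * hbar)) ^ CARD('n) * auto_wigner f (x, (2 / hbar) *\<^sub>R p)"
proof -
  have "(LINT \<tau>|lborel. f (x + (1/2) *\<^sub>R \<tau>) * cnj (f (x - (1/2) *\<^sub>R \<tau>)) * exp (- \<i> * complex_of_real ((p \<bullet> \<tau>) / hbar)))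
    = 2 ^ CARD('n) *\<^sub>R (LINT t|lborel. f (x + (1/2) *\<^sub>R (0 + 2 *\<^sub>R t)) * cnj (f (x - (1/2) *\<^sub>R (0 + 2 *\<^sub>R t))) * exp (- \<i> * complex_of_real ((p \<bullet> (0 + 2 *\<^sub>R t)) / hbar)))"
    by (subst integral_lborel_affine[where c=2 and t=0]) simp_all
  also have "\<dots> = 2 ^ CARD('n) *\<^sub>R cross_wigner f (\<lambda>x. cnj (f x)) (x, (2 / hbar) *\<^sub>R p)"
    by (simp add: cross_wigner_def cis_conv_exp)
  finally have eq: "(LINT \<tau>|lborel. f (x + (1/2) *\<^sub>R \<tau>) * cnj (f (x - (1/2) *\<^sub>R \<tau>)) * exp (- \<i> * complex_of_real ((p \<bullet> \<tau>) / hbar)))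
    = of_real (2 ^ CARD('n) * auto_wigner f (x, (2 / hbar) *\<^sub>R p))"
    by (simp add: cross_wigner_cnj_eq scaleR_conv_of_real)
  show ?thesis
    unfolding wigner_def prod.case eq of_real_mult[symmetric] Re_complex_of_real
    by (simp add: power_mult_distrib power_divide)
qed

text \<open>The rescaled negative set has measure at least \<open>pi ^ n / 4\<close> and lies in the
  preimage of the ball under rescaling of momenta; the bound on \<open>R0\<close> follows by
  comparing volumes and taking roots.\<close>

theorem theorem4:
  fixes hbar :: real and f :: "real^'n \<Rightarrow> complex"
    and R0 :: real and z0 :: "(real^'n) \<times> (real^'n)"
  assumes "hbar > 0"
    and "f \<in> L2"
    and "neg_part (wigner hbar f) \<noteq> {}"
    and "R0 > 0"
    and "neg_part (wigner hbar f) \<subseteq> ball z0 R0"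
  shows "R0 \<ge> (1/2) * sqrt ((hbar / 2) * root CARD('n) (fact CARD('n) / 2))"
proof -
  let ?n = "CARD('n)"
  have f: "square_integrable f"
    using assms(2) unfolding L2_def square_integrable_def by auto
  have neg_iff: "(x, p) \<in> neg_part (wigner hbar f) \<longleftrightarrow> auto_wigner f (x, (2 / hbar) *\<^sub>R p) < 0" for x p
  proof -
    have "(1 / (pi * hbar)) ^ ?n > 0" using assms(1) by simp
    from mult_less_cancel_left_pos[OF this, of _ 0] show ?thesis
      unfolding neg_part_def mem_Collect_eq Re_wigner_eq[OF assms(1)] mult_zero_right by blast
  qed
  obtain x p where "(x, p) \<in> neg_part (wigner hbar f)"
    using assms(3) by (metis equals0I surj_pair)
  then have "auto_wigner f (x, (2 / hbar) *\<^sub>R p) < 0" by (simp add: neg_iff)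
  from auto_wigner_neg_measure[OF f this]
  have "ennreal (pi ^ ?n / 4) \<le> emeasure lborel {z. auto_wigner f z < 0}" by simp
  also have "\<dots> \<le> emeasure lborel {(x, p). (x, (hbar / 2) *\<^sub>R p) \<in> ball z0 R0}"
  proof (rule emeasure_mono)
    show "{z. auto_wigner f z < 0} \<subseteq> {(x, p). (x, (hbar / 2) *\<^sub>R p) \<in> ball z0 R0}"
    proof (intro subsetI, unfold mem_Collect_eq split_beta)
      fix z assume "auto_wigner f z < 0"
      then have "(fst z, (hbar / 2) *\<^sub>R snd z) \<in> neg_part (wigner hbar f)"
        using assms(1) by (simp add: neg_iff)
      with assms(5) show "(fst z, (hbar / 2) *\<^sub>R snd z) \<in> ball z0 R0" by blast
    qed
    have "open ((\<lambda>z. (fst z, (hbar / 2) *\<^sub>R snd z)) -` ball z0 R0)"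
      by (intro open_vimage continuous_intros) auto
    then show "{(x, p). (x, (hbar / 2) *\<^sub>R p) \<in> ball z0 R0} \<in> sets lborel"
      unfolding vimage_def split_beta sets_lborel by (rule borel_open)
  qed
  \<comment> \<open>Multiplying by the Jacobian of the momentum scaling \<open>hbar / 2\<close>
    makes the right side the volume of the original ball.\<close>
  finally have "ennreal ((hbar / 2) ^ ?n) * ennreal (pi ^ ?n / 4)
    \<le> ennreal ((hbar / 2) ^ DIM(real^'n)) * emeasure lborel {(x, p). (x, (hbar / 2) *\<^sub>R p) \<in> ball z0 R0}"
    by (simp add: mult_left_mono)
  also have "\<dots> = emeasure lborel (ball z0 R0)"
    using assms(1) by (intro emeasure_scale_snd[symmetric]) auto
  \<comment> \<open>Phase space has the even dimension \<open>2 n\<close>, for which the unit ball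
    has volume \<open>pi ^ n / fact n\<close>.\<close>
  also have "\<dots> = ennreal (pi ^ ?n / fact ?n * R0 ^ (2 * ?n))"
  proof -
    have dim: "DIM((real^'n) \<times> (real^'n)) = 2 * ?n" by simp
    show ?thesis
      unfolding emeasure_ball[OF less_imp_le[OF assms(4)]] dim unit_ball_vol_even by (rule refl)
  qed
  finally have "ennreal ((hbar / 2) ^ ?n * (pi ^ ?n / 4)) \<le> ennreal (pi ^ ?n / fact ?n * R0 ^ (2 * ?n))"
    using assms(1) by (subst ennreal_mult) auto
  then have le: "(hbar / 2) ^ ?n * (pi ^ ?n / 4) \<le> pi ^ ?n / fact ?n * R0 ^ (2 * ?n)"
    by (rule ennreal_le_iff[THEN iffD1, rotated]) (use assms(4) in simp)
  have cancel: "a * F / 4 \<le> b" if "a * (P / 4) \<le> P / F * b" "P > 0" "F > 0" for a b P F :: real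
  proof -
    have "P * (a * F / 4) \<le> P * b" using that by (simp add: field_simps)
    then show ?thesis using that(2) by simp
  qed
  have key: "(hbar / 2) ^ ?n * fact ?n / 4 \<le> (R0\<^sup>2) ^ ?n"
    unfolding power_mult[symmetric] by (rule cancel[OF le]) simp_all
  \<comment> \<open>The claimed bound is the square root of \<open>(hbar / 2) * r / 4\<close>, so
    the \<open>n\<close>-th power of this number is compared with \<open>key\<close>.\<close>
  define r where "r = root ?n (fact ?n / 2)"
  have r: "r \<ge> 0" "r ^ ?n = fact ?n / 2" by (simp_all add: r_def)
  have "((hbar / 2) * r / 4) ^ ?n = (hbar / 2) ^ ?n * fact ?n / 2 / 4 ^ ?n"
    unfolding power_divide[of "hbar / 2 * r"] power_mult_distrib[of "hbar / 2"] r by simp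
  \<comment> \<open>Uses \<open>4 \<le> 4 ^ n\<close>, which holds because \<open>n\<close> is at
    least 1.\<close>
  also have "\<dots> \<le> (hbar / 2) ^ ?n * fact ?n / 2 / 4"
    using assms(1) self_le_power[of "4::real" ?n] by (intro divide_left_mono) auto
  also have "\<dots> \<le> (hbar / 2) ^ ?n * fact ?n / 4"
    using assms(1) by simp
  also note key
  finally have "(hbar / 2) * r / 4 \<le> R0\<^sup>2"
    by (subst (asm) power_mono_iff) (use assms(1) r in auto)
  then have "sqrt ((hbar / 2) * r / 4) \<le> R0"
    using assms(4) by (intro real_le_lsqrt) auto
  then show ?thesis
    using real_sqrt_divide[of "hbar / 2 * r" 4] unfolding real_sqrt_four r_def by linarith
qed

end
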